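(* Let $n\ge 2$, let $a<b$ be real numbers, and let $W\in C^{1,1}_{loc}(\mathbb{R})$ be a nonnegative potential such that $W'(a)=W'(b)=0$, $W'<0$ on $(a,b)$, and $W(b)=0$. Let $D\subset\mathbb{R}^n$ be a domain such that the radii of the balls contained in $\mathbb{R}^n\setminus D$ are uniformly bounded by a constant $\Lambda>0$. Assume $u\in C^2(\mathbb{R}^n)$ is a bounded entire solution of $\Delta u=W'(u)$ in $\mathbb{R}^n$ such that $\sup_{\mathbb{R}^n}u=b$ and $u(D)\subset(a,b]$. Then $u\equiv b$.
   Context: A domain is a connected open set. *)

theory Defs
  imports "HOL-Analysis.Analysis"
begin

definition C11_loc :: "(real \<Rightarrow> real) \<Rightarrow> bool" where
  "C11_loc W \<longleftrightarrow>
     (\<forall>x. W differentiable (at x)) \<and>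
     (\<forall>K. compact K \<longrightarrow> (\<exists>L. L-lipschitz_on K (deriv W)))"

definition has_partial_at :: "'n::finite \<Rightarrow> (real^'n \<Rightarrow> real) \<Rightarrow> real^'n \<Rightarrow> bool" where
  "has_partial_at i f x \<longleftrightarrow> (\<lambda>t::real. f (x + t *\<^sub>R axis i 1)) differentiable (at 0)"

text \<open>Meaningful only where \<open>has_partial_at i f x\<close> holds; \<open>deriv\<close> is a total function.\<close>

definition partial :: "'n::finite \<Rightarrow> (real^'n \<Rightarrow> real) \<Rightarrow> real^'n \<Rightarrow> real" where
  "partial i f x = deriv (\<lambda>t::real. f (x + t *\<^sub>R axis i 1)) 0"

definition C1 :: "(real^'n::finite \<Rightarrow> real) \<Rightarrow> bool" where
  "C1 f \<longleftrightarrow> (\<forall>i. (\<forall>x. has_partial_at i f x) \<and> continuous_on UNIV (partial i f))"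

text \<open>Continuity of \<open>f\<close> itself is not required separately in \<open>C1\<close> or \<open>C2\<close>:
  existence and continuity of all first partial derivatives imply it.\<close>

definition C2 :: "(real^'n::finite \<Rightarrow> real) \<Rightarrow> bool" where
  "C2 f \<longleftrightarrow> C1 f \<and> (\<forall>i. C1 (partial i f))"

definition laplacian :: "(real^'n::finite \<Rightarrow> real) \<Rightarrow> real^'n \<Rightarrow> real" where
  "laplacian f x = (\<Sum>i\<in>UNIV. partial i (partial i f) x)"

end

theory Submission
  imports Defs
begin

text \<open>
  Suppose \<open>u\<close> is not constantly \<open>b\<close>. The Modica estimate \<open>|Du|\<^sup>2 \<le> 2 W(u)\<close> makes \<open>b - u\<close> vary at most
  exponentially, so \<open>u\<close> is close to \<open>b\<close> on arbitrarily large balls, and it makes \<open>w = \<Phi>(u)\<close>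
  with \<open>\<Phi>' = (2 W + \<kappa>)\<^bsup>-1/2\<^esup>\<close> 1-Lipschitz on the whole space. Sliding a large ball carrying a radial
  strict subsolution, until \<open>u\<close> touches it on the bounding sphere at a level \<open>a'\<close> slightly above \<open>a\<close>, gives a
  point \<open>p\<close> and a unit vector \<open>e\<close> along which \<open>w\<close> grows at almost the maximal rate 1 up to
  \<open>q = p + R e\<close>, with \<open>R\<close> large. So the function \<open>z = w - w(q) + |x - q|\<close>, which is nonnegative everywhere, is
  nearly 0 at \<open>p\<close>; as it satisfies \<open>\<bar>\<Delta>z\<bar> \<le> K |Dz| + o(1)\<close> near \<open>p\<close>, a Hopf barrier shows that it is small
  on a ball of any prescribed radius about \<open>p\<close>. There \<open>w\<close> is close to \<open>w(q) - |x - q|\<close>, which lies below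
  \<open>\<Phi>(a)\<close> on a ball of radius larger than \<open>\<Lambda>\<close> beyond \<open>p\<close>; such a ball misses \<open>D\<close>, a contradiction.

  Neither elliptic regularity nor compactness of solutions is used. The gradient bound and the Modica
  estimate come from maximum principles for \<open>u(x) - u(y) - \<rho>(|x - y|)\<close>, which only involve second
  derivatives of \<open>u\<close>, whereas the classical \<open>P\<close>-function argument needs third derivatives.
\<close>

section \<open>Second-order jets\<close>

definition gradient :: "(real^'n::finite \<Rightarrow> real) \<Rightarrow> real^'n \<Rightarrow> real^'n" where
  "gradient f x = (\<chi> i. partial i f x)"

lemma has_partial_at_shift:
  assumes "has_partial_at i f (x + s *\<^sub>R axis i 1)"
  shows "((\<lambda>t. f (x + t *\<^sub>R axis i 1)) has_real_derivative partial i f (x + s *\<^sub>R axis i 1)) (at s)"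
proof -
  have "((\<lambda>t. f (x + s *\<^sub>R axis i 1 + t *\<^sub>R axis i 1)) has_real_derivative partial i f (x + s *\<^sub>R axis i 1)) (at 0)"
    using assms unfolding has_partial_at_def partial_def
    by (simp add: DERIV_deriv_iff_real_differentiable)
  then have "((\<lambda>t. f (x + s *\<^sub>R axis i 1 + (t - s) *\<^sub>R axis i 1)) has_real_derivative partial i f (x + s *\<^sub>R axis i 1)) (at s)"
    using DERIV_shift[of "\<lambda>t. f (x + s *\<^sub>R axis i 1 + t *\<^sub>R axis i 1)" _ s "-s"] by (simp add: algebra_simps)
  then show ?thesis by (simp add: algebra_simps)
qed

text \<open>The increment is switched on one coordinate at a time, and each switch is handled by the
  one-variable mean value theorem. The induction runs over the set \<open>A\<close> of coordinates
  already switched on.\<close>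

lemma C1_has_derivative:
  fixes f :: "real^'n::finite \<Rightarrow> real"
  assumes "C1 f"
  shows "(f has_derivative (\<lambda>h. gradient f x \<bullet> h)) (at x)"
proof -
  let ?P = "\<lambda>A h. (\<chi> i. if i \<in> A then h $ i else 0) :: real^'n"
  have main: "\<forall>e>0. \<exists>d>0. \<forall>h. norm h < d \<longrightarrow>
      \<bar>f (x + ?P A h) - f x - (\<Sum>i\<in>A. h $ i * partial i f x)\<bar> \<le> e * norm h" if "finite A" for A
    using that
  proof (induction A)
    case empty
    have "(\<chi> i. 0) = (0::real^'n)" by (simp add: vec_eq_iff)
    then show ?case by (auto intro: exI[of _ 1])
  next
    case (insert i A)
    show ?case
    proof (intro allI impI)
      fix e :: real assume "e > 0"
      then obtain d1 where d1: "d1 > 0" and h1: "\<And>h. norm h < d1 \<Longrightarrow>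
          \<bar>f (x + ?P A h) - f x - (\<Sum>i\<in>A. h $ i * partial i f x)\<bar> \<le> e/2 * norm h"
        using insert.IH[rule_format, of "e/2"] by auto
      have "isCont (partial i f) x"
        using assms by (simp add: C1_def continuous_on_eq_continuous_at)
      then obtain d2 where d2: "d2 > 0" and h2: "\<And>y. norm (y - x) < d2 \<Longrightarrow> \<bar>partial i f y - partial i f x\<bar> < e/2"
        using \<open>e > 0\<close> unfolding continuous_at_eps_delta dist_norm real_norm_def by (metis half_gt_zero)
      have "\<bar>f (x + ?P (insert i A) h) - f x - (\<Sum>j\<in>insert i A. h $ j * partial j f x)\<bar> \<le> e * norm h"
        if h: "norm h < min d1 d2" for h
      proof -
        let ?g = "\<lambda>t. f (x + ?P A h + t *\<^sub>R axis i 1)"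
        have der: "(?g has_real_derivative partial i f (x + ?P A h + t *\<^sub>R axis i 1)) (at t)" for t
          by (rule has_partial_at_shift) (use assms in \<open>simp add: C1_def\<close>)
        have eq: "?P (insert i A) h = ?P A h + h $ i *\<^sub>R axis i 1"
          using insert.hyps by (auto simp: vec_eq_iff axis_def)
        \<comment> \<open>Only \<open>\<bar>s\<bar> \<le> \<bar>h $ i\<bar>\<close> is kept of the
          mean value point, so that both signs of \<open>h $ i\<close> and the value 0 are treated
          alike.\<close>
        obtain s where s: "\<bar>s\<bar> \<le> \<bar>h $ i\<bar>" "?g (h $ i) - ?g 0 = h $ i * partial i f (x + ?P A h + s *\<^sub>R axis i 1)"
        proof (cases "h $ i" "0::real" rule: linorder_cases)
          case less
          from MVT2[OF less der] obtain z where "h $ i < z" "z < 0"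
            "?g 0 - ?g (h $ i) = (0 - h $ i) * partial i f (x + ?P A h + z *\<^sub>R axis i 1)" by auto
          with that[of z] show thesis by auto
        next
          case equal with that[of 0] show thesis by auto
        next
          case greater
          from MVT2[OF greater der] obtain z where "0 < z" "z < h $ i"
            "?g (h $ i) - ?g 0 = (h $ i - 0) * partial i f (x + ?P A h + z *\<^sub>R axis i 1)" by auto
          with that[of z] show thesis by auto
        qed
        have "norm (?P A h + s *\<^sub>R axis i 1) \<le> norm h"
          by (rule norm_le_componentwise_cart) (use s(1) insert.hyps in \<open>auto simp: axis_def\<close>)
        then have "\<bar>partial i f (x + ?P A h + s *\<^sub>R axis i 1) - partial i f x\<bar> < e/2"
          using h by (intro h2) (simp add: algebra_simps)
        then have b: "\<bar>h $ i * (partial i f (x + ?P A h + s *\<^sub>R axis i 1) - partial i f x)\<bar> \<le> norm h * (e/2)"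
          unfolding abs_mult using component_le_norm_cart[of h i] by (intro mult_mono) auto
        have "f (x + ?P (insert i A) h) - f x - (\<Sum>j\<in>insert i A. h $ j * partial j f x)
            = (f (x + ?P A h) - f x - (\<Sum>j\<in>A. h $ j * partial j f x))
              + h $ i * (partial i f (x + ?P A h + s *\<^sub>R axis i 1) - partial i f x)"
          using s(2) insert.hyps unfolding eq by (simp add: algebra_simps)
        also have "\<bar>\<dots>\<bar> \<le> e/2 * norm h + norm h * (e/2)"
          using h by (intro order_trans[OF abs_triangle_ineq add_mono[OF h1 b]]) simp
        finally show ?thesis by simp
      qed
      then show "\<exists>d>0. \<forall>h. norm h < d \<longrightarrow>
         \<bar>f (x + ?P (insert i A) h) - f x - (\<Sum>j\<in>insert i A. h $ j * partial j f x)\<bar> \<le> e * norm h"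
        using d1 d2 by (intro exI[of _ "min d1 d2"]) auto
    qed
  qed
  show ?thesis
    unfolding has_derivative_at_alt
  proof (intro conjI allI impI bounded_linear_inner_right)
    fix e :: real assume "e > 0"
    with main[of UNIV] obtain d where "d > 0" and d: "\<And>h. norm h < d \<Longrightarrow>
      \<bar>f (x + h) - f x - (\<Sum>i\<in>UNIV. h $ i * partial i f x)\<bar> \<le> e * norm h"
      by auto
    have "norm (f y - f x - gradient f x \<bullet> (y - x)) \<le> e * norm (y - x)" if "norm (y - x) < d" for y
      using d[OF that] by (simp add: inner_vec_def gradient_def algebra_simps)
    then show "\<exists>d>0. \<forall>y. norm (y - x) < d \<longrightarrow> norm (f y - f x - gradient f x \<bullet> (y - x)) \<le> e * norm (y - x)"
      using \<open>d > 0\<close> by blast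
  qed
qed

text \<open>\<open>g\<close> is a gradient field near \<open>x\<close> and \<open>H\<close> its
  derivative at the single point \<open>x\<close>. The local form admits functions that are singular
  elsewhere, such as the norm.\<close>

definition jet2 :: "(real^'n::finite \<Rightarrow> real) \<Rightarrow> (real^'n \<Rightarrow> real^'n) \<Rightarrow> real^'n^'n \<Rightarrow> real^'n \<Rightarrow> bool" where
  "jet2 f g H x \<longleftrightarrow>
     (\<forall>\<^sub>F y in nhds x. (f has_derivative (\<lambda>h. g y \<bullet> h)) (at y)) \<and>
     (g has_derivative (\<lambda>h. H *v h)) (at x)"

lemma jet2_has_derivative: "jet2 f g H x \<Longrightarrow> (f has_derivative (\<lambda>h. g x \<bullet> h)) (at x)"
  unfolding jet2_def by (blast dest: eventually_nhds_x_imp_x)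

lemma has_derivative_vecI:
  fixes g :: "'a::real_normed_vector \<Rightarrow> real^'n::finite"
  assumes "\<And>i. ((\<lambda>x. g x $ i) has_derivative (\<lambda>h. g' h $ i)) (at x)"
  shows "(g has_derivative g') (at x)"
  unfolding has_derivative_componentwise_within[of g]
  using assms by (auto simp: Basis_vec_def inner_axis)

lemma C2_jet2:
  assumes "C2 u"
  shows "jet2 u (gradient u) (\<chi> i. gradient (partial i u) x) x"
    and "trace (\<chi> i. gradient (partial i u) x) = laplacian u x"
proof -
  show "jet2 u (gradient u) (\<chi> i. gradient (partial i u) x) x"
    unfolding jet2_def
  proof (intro conjI always_eventually allI)
    show "(u has_derivative (\<lambda>h. gradient u y \<bullet> h)) (at y)" for y
      using assms by (intro C1_has_derivative) (simp add: C2_def)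
    show "(gradient u has_derivative (\<lambda>h. (\<chi> i. gradient (partial i u) x) *v h)) (at x)"
    proof (rule has_derivative_vecI)
      fix i
      have "(partial i u has_derivative (\<lambda>h. gradient (partial i u) x \<bullet> h)) (at x)"
        using assms by (intro C1_has_derivative) (simp add: C2_def)
      then show "((\<lambda>x. gradient u x $ i) has_derivative (\<lambda>h. ((\<chi> i. gradient (partial i u) x) *v h) $ i)) (at x)"
        by (simp add: gradient_def matrix_vector_mult_def inner_vec_def)
    qed
  qed
  show "trace (\<chi> i. gradient (partial i u) x) = laplacian u x"
    by (simp add: trace_def laplacian_def gradient_def)
qed

lemma jet2_add:
  assumes "jet2 f g H x" "jet2 f' g' H' x"
  shows "jet2 (\<lambda>y. f y + f' y) (\<lambda>y. g y + g' y) (H + H') x"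
  unfolding jet2_def
proof (intro conjI)
  show "\<forall>\<^sub>F y in nhds x. ((\<lambda>y. f y + f' y) has_derivative (\<lambda>h. (g y + g' y) \<bullet> h)) (at y)"
    using assms[unfolded jet2_def, THEN conjunct1]
    by eventually_elim (auto intro!: derivative_eq_intros simp: inner_add_left)
  show "((\<lambda>y. g y + g' y) has_derivative (\<lambda>h. (H + H') *v h)) (at x)"
    using assms[unfolded jet2_def, THEN conjunct2]
    by (auto intro!: derivative_eq_intros simp: matrix_vector_mult_add_rdistrib)
qed

text \<open>Chain rule for Hessians. As \<open>\<phi>'\<close> is differentiated at one point only,
  a profile whose derivative is a function of \<open>W\<close> qualifies without a second derivative
  of \<open>W\<close>.\<close>

lemma jet2_compose:
  fixes f :: "real^'n::finite \<Rightarrow> real"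
  assumes f: "jet2 f g H x"
    and \<phi>: "\<forall>\<^sub>F s in nhds (f x). (\<phi> has_real_derivative \<phi>' s) (at s)"
    and \<phi>': "(\<phi>' has_real_derivative \<phi>'') (at (f x))"
  shows "jet2 (\<lambda>y. \<phi> (f y)) (\<lambda>y. \<phi>' (f y) *\<^sub>R g y) (\<chi> i j. \<phi>' (f x) * H $ i $ j + \<phi>'' * g x $ i * g x $ j) x"
  unfolding jet2_def
proof (intro conjI)
  have fx: "(f has_derivative (\<lambda>h. g x \<bullet> h)) (at x)" by (rule jet2_has_derivative[OF f])
  then have "isCont f x" by (rule has_derivative_continuous)
  then have "(f \<longlongrightarrow> f x) (nhds x)" by (simp add: isCont_def tendsto_at_iff_tendsto_nhds)
  then have "\<forall>\<^sub>F y in nhds x. (\<phi> has_real_derivative \<phi>' (f y)) (at (f y))"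
    by (rule eventually_compose_filterlim[OF \<phi>])
  with f[unfolded jet2_def, THEN conjunct1]
  show "\<forall>\<^sub>F y in nhds x. ((\<lambda>y. \<phi> (f y)) has_derivative (\<lambda>h. (\<phi>' (f y) *\<^sub>R g y) \<bullet> h)) (at y)"
  proof eventually_elim
    case (elim y)
    show ?case
      by (rule has_derivative_eq_rhs[OF has_derivative_compose[OF elim(1) elim(2)[unfolded has_field_derivative_def]]]) auto
  qed
  have gx: "(g has_derivative (\<lambda>h. H *v h)) (at x)" using f by (simp add: jet2_def)
  have d: "((\<lambda>y. \<phi>' (f y)) has_derivative (\<lambda>h. \<phi>'' * (g x \<bullet> h))) (at x)"
    using has_derivative_compose[OF fx \<phi>'[unfolded has_field_derivative_def]] .
  have "((\<lambda>y. \<phi>' (f y) *\<^sub>R g y) has_derivative (\<lambda>h. \<phi>' (f x) *\<^sub>R (H *v h) + (\<phi>'' * (g x \<bullet> h)) *\<^sub>R g x)) (at x)"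
    by (rule has_derivative_scaleR[OF d gx])
  moreover have "\<phi>' (f x) *\<^sub>R (H *v h) + (\<phi>'' * (g x \<bullet> h)) *\<^sub>R g x
      = (\<chi> i j. \<phi>' (f x) * H $ i $ j + \<phi>'' * g x $ i * g x $ j) *v h" for h
    by (simp add: vec_eq_iff matrix_vector_mult_def inner_vec_def sum_distrib_left algebra_simps sum.distrib)
  ultimately show "((\<lambda>y. \<phi>' (f y) *\<^sub>R g y) has_derivative
      (\<lambda>h. (\<chi> i j. \<phi>' (f x) * H $ i $ j + \<phi>'' * g x $ i * g x $ j) *v h)) (at x)"
    by simp
qed

lemma trace_compose:
  fixes H :: "real^'n::finite^'n"
  shows "trace (\<chi> i j. c * H $ i $ j + d * v $ i * v $ j) = c * trace H + d * (norm v)\<^sup>2"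
  by (simp add: trace_def sum.distrib sum_distrib_left power2_norm_eq_inner inner_vec_def algebra_simps)

lemma jet2_norm_sq: "jet2 (\<lambda>x. (norm (x - q))\<^sup>2) (\<lambda>x. 2 *\<^sub>R (x - q)) (2 *\<^sub>R mat 1) x"
  unfolding jet2_def power2_norm_eq_inner
  by (intro conjI always_eventually allI)
     (auto intro!: derivative_eq_intros simp: inner_commute scaleR_matrix_vector_assoc[symmetric])

text \<open>Composes the square root with the squared norm. Only the trace of the Hessian is
  exported: it is the curvature term that every radial barrier has to absorb.\<close>

lemma jet2_norm:
  fixes x q :: "real^'n::finite"
  assumes "x \<noteq> q"
  shows "\<exists>H. jet2 (\<lambda>y. norm (y - q)) (\<lambda>y. (1 / norm (y - q)) *\<^sub>R (y - q)) H x
           \<and> trace H = (real CARD('n) - 1) / norm (x - q)"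
proof -
  have pos: "(norm (x - q))\<^sup>2 > 0" using assms by simp
  have 1: "\<forall>\<^sub>F s in nhds ((norm (x - q))\<^sup>2). (sqrt has_real_derivative 1 / (2 * sqrt s)) (at s)"
    by (rule eventually_mono[OF eventually_nhds_in_open[of "{0<..}"]])
       (use pos in \<open>auto intro!: derivative_eq_intros simp: field_simps\<close>)
  have 2: "((\<lambda>s. 1 / (2 * sqrt s)) has_real_derivative - 1 / (4 * norm (x - q) ^ 3)) (at ((norm (x - q))\<^sup>2))"
    using pos by (auto intro!: derivative_eq_intros simp: field_simps power_numeral_reduce)
  let ?H = "\<chi> i j. 1 / (2 * sqrt ((norm (x - q))\<^sup>2)) * (2 *\<^sub>R mat 1 :: real^'n^'n) $ i $ j
    + - 1 / (4 * norm (x - q) ^ 3) * (2 *\<^sub>R (x - q)) $ i * (2 *\<^sub>R (x - q)) $ j"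
  have "jet2 (\<lambda>y. sqrt ((norm (y - q))\<^sup>2)) (\<lambda>y. (1 / (2 * sqrt ((norm (y - q))\<^sup>2))) *\<^sub>R 2 *\<^sub>R (y - q)) ?H x"
    by (rule jet2_compose[OF jet2_norm_sq 1 2])
  moreover have "trace ?H = (real CARD('n) - 1) / norm (x - q)"
    unfolding trace_compose norm_scaleR using assms
    by (simp add: trace_def mat_def power_mult_distrib field_simps power_numeral_reduce)
  ultimately show ?thesis
    by (intro exI[of _ ?H]) simp
qed

section \<open>Second-order conditions at extrema\<close>

lemma DERIV2_local_max:
  fixes f f' :: "real \<Rightarrow> real"
  assumes f: "\<forall>\<^sub>F t in nhds x. (f has_real_derivative f' t) (at t)"
    and f': "(f' has_real_derivative c) (at x)"
    and max: "\<forall>\<^sub>F t in nhds x. f t \<le> f x"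
  shows "f' x = 0" "c \<le> 0"
proof -
  obtain d where "d > 0" and d: "\<And>t. dist t x < d \<Longrightarrow> (f has_real_derivative f' t) (at t) \<and> f t \<le> f x"
    using eventually_conj[OF f max] unfolding eventually_nhds_metric by blast
  show 0: "f' x = 0"
    using DERIV_local_max[of f "f' x" x d] d \<open>d > 0\<close> by (auto simp: dist_real_def abs_minus_commute)
  show "c \<le> 0"
  proof (rule ccontr)
    \<comment> \<open>Since \<open>f' x = 0\<close>, a positive \<open>c\<close> makes
      \<open>f'\<close> positive just to the right of \<open>x\<close>, and the mean value theorem
      then lifts \<open>f\<close> above \<open>f x\<close>.\<close>
    assume "\<not> c \<le> 0"
    with DERIV_pos_inc_right[OF f'] obtain e where "e > 0" and e: "\<And>h. 0 < h \<Longrightarrow> h < e \<Longrightarrow> f' x < f' (x + h)"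
      by auto
    define h where "h = min d e / 2"
    have h: "0 < h" "h < d" "h < e" using \<open>d > 0\<close> \<open>e > 0\<close> by (auto simp: h_def)
    have "\<exists>z. x < z \<and> z < x + h \<and> f (x + h) - f x = (x + h - x) * f' z"
      using h by (intro MVT2 d[THEN conjunct1]) (auto simp: dist_real_def)
    then obtain z where z: "x < z" "z < x + h" "f (x + h) - f x = h * f' z" by auto
    have "f' z > 0" using e[of "z - x"] z h 0 by auto
    then have "f (x + h) > f x" using z h by (smt (verit) mult_pos_pos)
    moreover have "f (x + h) \<le> f x" using d[of "x + h"] h by (auto simp: dist_real_def)
    ultimately show False by simp
  qed
qed

lemma jet2_line:
  assumes "jet2 f g H x"
  shows "\<forall>\<^sub>F t in nhds (0::real). ((\<lambda>t. f (x + t *\<^sub>R v)) has_real_derivative g (x + t *\<^sub>R v) \<bullet> v) (at t)"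
    and "((\<lambda>t. g (x + t *\<^sub>R v) \<bullet> v) has_real_derivative (H *v v) \<bullet> v) (at (0::real))"
proof -
  have "filterlim (\<lambda>t::real. x + t *\<^sub>R v) (nhds x) (nhds 0)"
    by (auto intro!: tendsto_eq_intros filterlim_ident)
  then have "\<forall>\<^sub>F t in nhds (0::real). (f has_derivative (\<lambda>h. g (x + t *\<^sub>R v) \<bullet> h)) (at (x + t *\<^sub>R v))"
    using assms[unfolded jet2_def, THEN conjunct1] by (rule eventually_compose_filterlim[rotated])
  then show "\<forall>\<^sub>F t in nhds (0::real). ((\<lambda>t. f (x + t *\<^sub>R v)) has_real_derivative g (x + t *\<^sub>R v) \<bullet> v) (at t)"
  proof eventually_elim
    case (elim t)
    have "((\<lambda>t. x + t *\<^sub>R v) has_derivative (\<lambda>s. s *\<^sub>R v)) (at t)"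
      by (auto intro!: derivative_eq_intros)
    from has_derivative_compose[OF this elim] show ?case
      by (simp add: has_field_derivative_def mult.commute[of _ "_ \<bullet> _"])
  qed
  have l: "((\<lambda>t. x + t *\<^sub>R v) has_derivative (\<lambda>s. s *\<^sub>R v)) (at (0::real))"
    by (auto intro!: derivative_eq_intros)
  have "(g has_derivative (\<lambda>h. H *v h)) (at (x + 0 *\<^sub>R v))"
    using assms by (simp add: jet2_def)
  from has_derivative_inner_left[OF has_derivative_compose[OF l this], of v]
  show "((\<lambda>t. g (x + t *\<^sub>R v) \<bullet> v) has_real_derivative (H *v v) \<bullet> v) (at (0::real))"
    by (simp add: has_field_derivative_def matrix_vector_mult_scaleR mult.commute[of _ "_ \<bullet> _"])
qed

lemma trace_eq_sum_axis: "trace (H::real^'n::finite^'n) = (\<Sum>i\<in>UNIV. (H *v axis i 1) \<bullet> axis i 1)"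
  by (simp add: trace_def inner_axis matrix_vector_mult_basis column_def)

text \<open>The one-variable test along every line makes the quadratic form of \<open>H\<close>
  nonnegative; the trace is its sum over the coordinate axes.\<close>

lemma jet2_local_min:
  assumes j: "jet2 f g H x" and min: "\<forall>\<^sub>F y in nhds x. f x \<le> f y"
  shows "g x = 0" "trace H \<ge> 0"
proof -
  have "(\<lambda>h. g x \<bullet> h) = (\<lambda>h. 0)"
    using has_derivative_local_min[OF jet2_has_derivative[OF j]] min
    by (auto simp: eventually_nhds_conv_at)
  then have "g x \<bullet> g x = 0" by meson
  then show "g x = 0" by simp
  have "0 \<le> (H *v v) \<bullet> v" for v
  proof -
    have "filterlim (\<lambda>t::real. x + t *\<^sub>R v) (nhds x) (nhds 0)"
      by (auto intro!: tendsto_eq_intros filterlim_ident)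
    then have m: "\<forall>\<^sub>F t in nhds (0::real). - f (x + t *\<^sub>R v) \<le> - f (x + 0 *\<^sub>R v)"
      using eventually_compose_filterlim[OF min] by simp
    have "- ((H *v v) \<bullet> v) \<le> 0"
      by (rule DERIV2_local_max(2)[OF _ _ m])
         (use jet2_line[OF j, of v] in \<open>auto intro!: derivative_intros elim: eventually_mono\<close>)
    then show ?thesis by simp
  qed
  then show "trace H \<ge> 0" unfolding trace_eq_sum_axis by (intro sum_nonneg) auto
qed

section \<open>A two-point maximum principle\<close>

text \<open>The \<open>b i\<close> are the reflections of the axes in the hyperplane orthogonal to
  \<open>e\<close>, hence an orthonormal basis, and the trace is the sum of the quadratic form over
  any such basis.\<close>

lemma sum_reflected_axes:
  fixes H :: "real^'n::finite^'n"
  assumes e: "norm e = 1"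
  defines "b \<equiv> \<lambda>i. axis i 1 - (2 * e $ i) *\<^sub>R e"
  shows "(\<Sum>i\<in>UNIV. (H *v b i) \<bullet> b i) = trace H"
proof -
  have b: "(H *v b i) \<bullet> b i = (H *v axis i 1) \<bullet> axis i 1 - 2 * ((e $ i *\<^sub>R (H *v axis i 1)) \<bullet> e)
      - 2 * ((H *v e) \<bullet> (e $ i *\<^sub>R axis i 1)) + 4 * (e $ i)\<^sup>2 * ((H *v e) \<bullet> e)" for i
    unfolding b_def
    by (simp add: matrix_vector_mult_diff_distrib matrix_vector_mult_scaleR inner_diff_left inner_diff_right
        power2_eq_square algebra_simps)
  have e1: "(\<Sum>i\<in>UNIV. e $ i *\<^sub>R axis i 1) = e"
    using basis_expansion[of e] by (simp add: scalar_mult_eq_scaleR)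
  have e2: "(\<Sum>i\<in>UNIV. e $ i *\<^sub>R (H *v axis i 1)) = H *v e"
    by (subst (2) e1[symmetric]) (simp add: matrix_vector_mult_scaleR linear_sum[OF matrix_vector_mul_linear])
  have e3: "(\<Sum>i\<in>UNIV. (e $ i)\<^sup>2) = 1"
    using e by (simp add: norm_eq_sqrt_inner inner_vec_def power2_eq_square)
  have "(\<Sum>i\<in>UNIV. (H *v b i) \<bullet> b i) = trace H - 2 * ((\<Sum>i\<in>UNIV. e $ i *\<^sub>R (H *v axis i 1)) \<bullet> e)
      - 2 * ((H *v e) \<bullet> (\<Sum>i\<in>UNIV. e $ i *\<^sub>R axis i 1)) + 4 * (\<Sum>i\<in>UNIV. (e $ i)\<^sup>2) * ((H *v e) \<bullet> e)"
    unfolding b trace_eq_sum_axis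
    by (simp only: sum.distrib sum_subtractf sum_distrib_left sum_distrib_right inner_sum_left inner_sum_right mult.assoc)
  then show ?thesis unfolding e1 e2 e3 by simp
qed

text \<open>
  The maximum of the penalised two-point function is perturbed by moving \<open>x\<close> in the direction
  \<open>e\<^sub>i\<close> and \<open>y\<close> in the direction of its reflection in the hyperplane orthogonal to \<open>e = (x - y)/|x - y|\<close>;
  then \<open>x - y\<close> moves along \<open>e\<close>, so only \<open>\<rho>\<close> and no Hessian of the norm enters.
\<close>

lemma two_point_maximum:
  fixes w :: "real^'n::finite \<Rightarrow> real"
  assumes w: "\<And>x. jet2 w g (H x) x"
    and B: "\<And>x y. w x - w y \<le> B"
    and R: "B \<le> \<rho> R"
    and \<rho>: "\<And>t. 0 \<le> t \<Longrightarrow> t \<le> R \<Longrightarrow> 0 \<le> \<rho> t"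
    and cont: "continuous_on {0..R} \<rho>"
    and d1: "\<And>t. 0 < t \<Longrightarrow> t < R \<Longrightarrow> (\<rho> has_real_derivative \<rho>1 t) (at t)"
    and d2: "\<And>t. 0 < t \<Longrightarrow> t < R \<Longrightarrow> (\<rho>1 has_real_derivative \<rho>2 t) (at t)"
    and viol: "norm (x0 - y0) \<le> R" "w x0 - w y0 > \<rho> (norm (x0 - y0))"
    and \<epsilon>: "\<epsilon> > 0"
  obtains x y r e where "r = norm (x - y)" "0 < r" "r < R" "norm e = 1"
    "norm (g x - \<rho>1 r *\<^sub>R e) \<le> \<epsilon>" "norm (g y - \<rho>1 r *\<^sub>R e) \<le> \<epsilon>"
    "trace (H x) - trace (H y) \<le> 4 * \<rho>2 r + \<epsilon>"
proof -
  define m where "m = w x0 - w y0 - \<rho> (norm (x0 - y0))"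
  define N where "N = (norm x0)\<^sup>2 + (norm y0)\<^sup>2"
  have m: "m > 0" using viol by (simp add: m_def)
  have mB: "m \<le> B" using B[of x0 y0] \<rho>[of "norm (x0 - y0)"] viol by (simp add: m_def)
  have N: "N \<ge> 0" by (simp add: N_def)
  \<comment> \<open>The three bounds serve, in this order, to keep the penalised maximum positive,
    to bound the penalty's share \<open>4 n \<delta>\<close> in the traces by
    \<open>\<epsilon>\<close>, and to bound its gradients by \<open>\<epsilon>\<close>.\<close>
  define \<delta> where "\<delta> = min (m / (2 * (N + 1))) (min (\<epsilon> / (4 * real CARD('n))) (\<epsilon>\<^sup>2 / (4 * B)))"
  have \<delta>: "\<delta> > 0" using m mB N \<epsilon> by (simp add: \<delta>_def)
  have "\<delta> \<le> m / (2 * (N + 1))" by (simp add: \<delta>_def)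
  then have \<delta>N: "\<delta> * N \<le> m / 2"
    using N m \<delta> by (simp add: field_simps)
  have \<delta>n: "4 * real CARD('n) * \<delta> \<le> \<epsilon>"
  proof -
    have "\<delta> \<le> \<epsilon> / (4 * real CARD('n))" by (simp add: \<delta>_def)
    then show ?thesis by (simp add: field_simps)
  qed
  have \<delta>B: "4 * B * \<delta> \<le> \<epsilon>\<^sup>2"
  proof -
    have "\<delta> \<le> \<epsilon>\<^sup>2 / (4 * B)" by (simp add: \<delta>_def)
    then show ?thesis using m mB by (simp add: field_simps)
  qed
  define M where "M = (\<lambda>x y. w x - w y - \<rho> (norm (x - y)) - \<delta> * ((norm x)\<^sup>2 + (norm y)\<^sup>2))"
  define S where "S = {z :: (real^'n) \<times> (real^'n). norm (fst z - snd z) \<le> R \<and> (norm (fst z))\<^sup>2 + (norm (snd z))\<^sup>2 \<le> B / \<delta>}"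
  have cw: "continuous_on A w" for A
    using has_derivative_continuous[OF jet2_has_derivative[OF w]] by (simp add: continuous_at_imp_continuous_on)
  have "bounded S"
  proof (rule boundedI)
    fix z assume "z \<in> S"
    then have "norm z \<le> sqrt (B / \<delta>)"
      by (cases z) (auto simp: S_def norm_Pair intro!: real_sqrt_le_mono)
    then show "norm z \<le> sqrt (B / \<delta>)" .
  qed
  moreover have "closed S" unfolding S_def
    by (intro closed_Collect_conj closed_Collect_le continuous_intros)
  ultimately have "compact S" by (simp add: compact_eq_bounded_closed)
  moreover have in0: "(x0, y0) \<in> S"
  proof -
    have "N * \<delta> \<le> B" using \<delta>N m mB by (simp add: mult.commute)
    then show ?thesis using viol \<delta> by (simp add: S_def N_def[symmetric] pos_le_divide_eq)
  qed
  moreover have "continuous_on S (\<lambda>z. M (fst z) (snd z))"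
  proof -
    have "continuous_on S (\<lambda>z. w (fst z))" "continuous_on S (\<lambda>z. w (snd z))"
      by (auto intro!: continuous_on_compose2[OF cw[of UNIV]] continuous_intros)
    moreover have "continuous_on S (\<lambda>z. \<rho> (norm (fst z - snd z)))"
      by (rule continuous_on_compose2[OF cont]) (auto simp: S_def intro!: continuous_intros)
    ultimately show ?thesis unfolding M_def by (intro continuous_intros) auto
  qed
  ultimately obtain z where z: "z \<in> S" "\<forall>z'\<in>S. M (fst z') (snd z') \<le> M (fst z) (snd z)"
    using continuous_attains_sup[of S "\<lambda>z. M (fst z) (snd z)"] by blast
  define x y where "x = fst z" and "y = snd z"
  have xyS: "(x, y) \<in> S" and mx: "\<And>x' y'. (x', y') \<in> S \<Longrightarrow> M x' y' \<le> M x y"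
    using z by (auto simp: x_def y_def)
  have "M x0 y0 = m - \<delta> * N" by (simp add: M_def m_def N_def)
  then have "M x0 y0 \<ge> m / 2" using \<delta>N by simp
  then have Mpos: "M x y > 0" using mx[OF in0] m by simp
  \<comment> \<open>Outside \<open>S\<close> but within distance \<open>R\<close> the penalty
    exceeds \<open>B\<close>, so \<open>M\<close> is negative there and the maximum over
    \<open>S\<close> is one over the whole strip.\<close>
  have max: "M x' y' \<le> M x y" if "norm (x' - y') \<le> R" for x' y'
  proof (cases "(x', y') \<in> S")
    case False
    then have "(norm x')\<^sup>2 + (norm y')\<^sup>2 > B / \<delta>" using that by (simp add: S_def)
    then have "\<delta> * ((norm x')\<^sup>2 + (norm y')\<^sup>2) > B" using \<delta> by (simp add: field_simps)
    then have "M x' y' < 0" using B[of x' y'] \<rho>[of "norm (x' - y')"] that by (simp add: M_def)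
    then show ?thesis using Mpos by simp
  qed (use mx in auto)
  define r where "r = norm (x - y)"
  have rR: "r \<le> R" using xyS by (simp add: S_def r_def)
  have pen: "\<delta> * ((norm x)\<^sup>2 + (norm y)\<^sup>2) \<ge> 0" using \<delta> by simp
  have wr: "w x - w y - \<rho> r > 0" using Mpos pen by (simp add: M_def r_def)
  \<comment> \<open>Positivity of \<open>M\<close> keeps the maximum off both ends of
    \<open>[0, R]\<close>: \<open>\<rho> R\<close> is at least the oscillation \<open>B\<close>, and
    \<open>\<rho> 0 \<ge> 0\<close> excludes \<open>x = y\<close>.\<close>
  have "r \<noteq> R" using wr B[of x y] R by auto
  with rR have rR: "r < R" by simp
  have "x \<noteq> y" using wr \<rho>[of 0] rR r_def by auto
  then have r0: "r > 0" by (simp add: r_def)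
  define e where "e = (1 / r) *\<^sub>R (x - y)"
  have e: "norm e = 1" using r0 by (simp add: e_def r_def)
  have xe: "x - y = r *\<^sub>R e" using r0 by (simp add: e_def)
  have "\<delta> * ((norm x)\<^sup>2 + (norm y)\<^sup>2) \<le> B"
    using Mpos B[of x y] \<rho>[of r] r0 rR by (simp add: M_def r_def)
  then have "\<delta> * (\<delta> * ((norm x)\<^sup>2 + (norm y)\<^sup>2)) \<le> \<delta> * B" using \<delta> by simp
  then have dd: "4 * (\<delta> * \<delta> * (norm x)\<^sup>2) + 4 * (\<delta> * \<delta> * (norm y)\<^sup>2) \<le> \<epsilon>\<^sup>2"
    using \<delta>B by (simp add: algebra_simps)
  have p2: "\<delta> * \<delta> * (norm x)\<^sup>2 \<ge> 0" "\<delta> * \<delta> * (norm y)\<^sup>2 \<ge> 0" by simp_all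
  have dx: "2 * \<delta> * norm x \<le> \<epsilon>"
    by (rule power2_le_imp_le) (use dd p2 \<epsilon> in \<open>simp_all add: power2_eq_square algebra_simps\<close>)
  have dy: "2 * \<delta> * norm y \<le> \<epsilon>"
    by (rule power2_le_imp_le) (use dd p2 \<epsilon> in \<open>simp_all add: power2_eq_square algebra_simps\<close>)
  have nrm: "((\<lambda>z. norm (z - q)) has_derivative (\<lambda>h. (1 / norm (z - q)) *\<^sub>R (z - q) \<bullet> h)) (at z)" if "z \<noteq> q" for z q :: "real^'n"
    using jet2_norm[OF that] jet2_has_derivative by blast
  have gx: "g x - \<rho>1 r *\<^sub>R e = (2 * \<delta>) *\<^sub>R x"
  proof -
    have "((\<lambda>z. M z y) has_derivative (\<lambda>h. g x \<bullet> h - \<rho>1 r * (e \<bullet> h) - \<delta> * (2 * (x \<bullet> h)))) (at x)"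
      unfolding M_def power2_norm_eq_inner
      using has_derivative_compose[OF nrm[OF \<open>x \<noteq> y\<close>] d1[OF r0 rR, unfolded has_field_derivative_def r_def]] \<open>x \<noteq> y\<close>
      by (auto intro!: derivative_eq_intros jet2_has_derivative[OF w] simp: e_def r_def inner_commute)
    moreover have "\<forall>\<^sub>F z in at x. M z y \<le> M x y"
    proof -
      have "\<forall>\<^sub>F z in at x. norm (z - y) < R"
        using rR unfolding r_def
        by (intro order_tendstoD(2)[of "\<lambda>z. norm (z - y)" "norm (x - y)"]) (auto intro!: tendsto_intros)
      then show ?thesis by eventually_elim (simp add: max)
    qed
    ultimately have "(\<lambda>h. g x \<bullet> h - \<rho>1 r * (e \<bullet> h) - \<delta> * (2 * (x \<bullet> h))) = (\<lambda>h. 0)"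
      by (rule has_derivative_local_max)
    then have "(g x - \<rho>1 r *\<^sub>R e - (2 * \<delta>) *\<^sub>R x) \<bullet> h = 0" for h
      by (simp add: fun_eq_iff inner_diff_left algebra_simps)
    then have "g x - \<rho>1 r *\<^sub>R e - (2 * \<delta>) *\<^sub>R x = 0" using inner_eq_zero_iff by blast
    then show ?thesis by simp
  qed
  have gy: "g y - \<rho>1 r *\<^sub>R e = - ((2 * \<delta>) *\<^sub>R y)"
  proof -
    have ry: "norm (y - x) = r" by (simp add: r_def norm_minus_commute)
    have "((\<lambda>z. \<rho> (norm (x - z))) has_derivative (\<lambda>h. \<rho>1 r * (- (e \<bullet> h)))) (at y)"
      unfolding norm_minus_commute[of x]
      by (rule has_derivative_eq_rhs, rule has_derivative_compose[OF nrm d1[OF r0 rR, unfolded has_field_derivative_def ry[symmetric]]])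
         (use \<open>x \<noteq> y\<close> in \<open>auto simp: e_def ry inner_diff_left algebra_simps\<close>)
    then have "((\<lambda>z. M x z) has_derivative (\<lambda>h. - (g y \<bullet> h) + \<rho>1 r * (e \<bullet> h) - \<delta> * (2 * (y \<bullet> h)))) (at y)"
      unfolding M_def power2_norm_eq_inner
      by (auto intro!: derivative_eq_intros jet2_has_derivative[OF w] simp: inner_commute)
    moreover have "\<forall>\<^sub>F z in at y. M x z \<le> M x y"
    proof -
      have "\<forall>\<^sub>F z in at y. norm (x - z) < R"
        using rR unfolding r_def
        by (intro order_tendstoD(2)[of "\<lambda>z. norm (x - z)" "norm (x - y)"]) (auto intro!: tendsto_intros)
      then show ?thesis by eventually_elim (simp add: max)
    qed
    ultimately have "(\<lambda>h. - (g y \<bullet> h) + \<rho>1 r * (e \<bullet> h) - \<delta> * (2 * (y \<bullet> h))) = (\<lambda>h. 0)"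
      by (rule has_derivative_local_max)
    then have "(g y - \<rho>1 r *\<^sub>R e + (2 * \<delta>) *\<^sub>R y) \<bullet> h = 0" for h
      by (simp add: fun_eq_iff inner_diff_left inner_add_left algebra_simps)
    then have "g y - \<rho>1 r *\<^sub>R e + (2 * \<delta>) *\<^sub>R y = 0" using inner_eq_zero_iff by blast
    then show ?thesis by (simp add: eq_neg_iff_add_eq_0)
  qed
  define b where "b = (\<lambda>i. axis i 1 - (2 * e $ i) *\<^sub>R e)"
  have ee: "e \<bullet> e = 1" using e by (simp add: norm_eq_sqrt_inner)
  have nb: "b i \<bullet> b i = 1" for i
    using ee by (simp add: b_def inner_diff_left inner_diff_right inner_axis inner_axis' inner_axis_axis
        inner_commute[of "axis i 1"] algebra_simps)
  have dir: "(H x *v axis i 1) \<bullet> axis i 1 - (H y *v b i) \<bullet> b i - 4 * (e $ i)\<^sup>2 * \<rho>2 r - 4 * \<delta> \<le> 0" for i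
  proof -
    \<comment> \<open>\<open>axis i 1 - b i = (2 * e $ i) *\<^sub>R e\<close>, so the distance of
      the moving points is exactly \<open>r + t * c\<close> for small \<open>t\<close>.\<close>
    define c where "c = 2 * e $ i"
    define f where "f = (\<lambda>t. w (x + t *\<^sub>R axis i 1) - w (y + t *\<^sub>R b i) - \<rho> (r + t * c)
        - \<delta> * ((norm (x + t *\<^sub>R axis i 1))\<^sup>2 + (norm (y + t *\<^sub>R b i))\<^sup>2))"
    define f' where "f' = (\<lambda>t. g (x + t *\<^sub>R axis i 1) \<bullet> axis i 1 - g (y + t *\<^sub>R b i) \<bullet> b i - \<rho>1 (r + t * c) * c
        - \<delta> * (2 * ((x + t *\<^sub>R axis i 1) \<bullet> axis i 1) + 2 * ((y + t *\<^sub>R b i) \<bullet> b i)))"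
    have "((\<lambda>t. r + t * c) \<longlongrightarrow> r + 0 * c) (nhds 0)" by (intro tendsto_intros filterlim_ident)
    then have near: "\<forall>\<^sub>F t in nhds 0. 0 < r + t * c \<and> r + t * c < R"
      using r0 rR order_tendstoD[of "\<lambda>t. r + t * c" "r + 0 * c"] by (auto intro: eventually_conj)
    have "\<forall>\<^sub>F t in nhds 0. (f has_real_derivative f' t) (at t)"
      using near jet2_line(1)[OF w, of x "axis i 1"] jet2_line(1)[OF w, of y "b i"]
    proof eventually_elim
      case (elim t)
      have "((\<lambda>t. \<rho> (r + t * c)) has_real_derivative \<rho>1 (r + t * c) * c) (at t)"
        by (rule DERIV_chain2[OF d1]) (use elim in \<open>auto intro!: derivative_eq_intros\<close>)
      moreover have sq: "((\<lambda>t. (norm (q + t *\<^sub>R v))\<^sup>2) has_real_derivative 2 * ((q + t *\<^sub>R v) \<bullet> v)) (at t)" for q v :: "real^'n"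
        unfolding power2_norm_eq_inner has_field_derivative_def
        by (auto intro!: derivative_eq_intros simp: inner_add_left inner_add_right inner_commute algebra_simps)
      ultimately show ?case
        unfolding f_def f'_def using elim by (intro DERIV_diff DERIV_cmult DERIV_add) auto
    qed
    moreover have "(f' has_real_derivative (H x *v axis i 1) \<bullet> axis i 1 - (H y *v b i) \<bullet> b i - \<rho>2 r * c * c
        - \<delta> * (2 * (axis i 1 \<bullet> (axis i 1 :: real^'n)) + 2 * (b i \<bullet> b i))) (at 0)"
    proof -
      have 1: "((\<lambda>t. \<rho>1 (r + t * c)) has_real_derivative \<rho>2 r * c) (at 0)"
        by (rule DERIV_cong[OF DERIV_chain2[where g="\<lambda>t. r + t * c", OF d2]])
           (use r0 rR in \<open>auto intro!: derivative_eq_intros\<close>)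
      have 2: "((\<lambda>t. (q + t *\<^sub>R v) \<bullet> v) has_real_derivative v \<bullet> v) (at 0)" for q v :: "real^'n"
        unfolding has_field_derivative_def
        by (auto intro!: derivative_eq_intros simp: inner_add_left algebra_simps)
      show ?thesis
        unfolding f'_def
        by (intro DERIV_diff DERIV_cmult DERIV_add DERIV_cmult_right 1 2 jet2_line(2)[OF w])
    qed
    moreover have "\<forall>\<^sub>F t in nhds 0. f t \<le> f 0"
      using near
    proof eventually_elim
      case (elim t)
      have "x + t *\<^sub>R axis i 1 - (y + t *\<^sub>R b i) = (r + t * c) *\<^sub>R e"
        using xe by (simp add: b_def c_def algebra_simps)
      then have n: "norm (x + t *\<^sub>R axis i 1 - (y + t *\<^sub>R b i)) = r + t * c" using elim e by simp
      then have "M (x + t *\<^sub>R axis i 1) (y + t *\<^sub>R b i) \<le> M x y" using elim by (intro max) simp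
      then show ?case using n by (simp add: M_def f_def r_def)
    qed
    ultimately have "(H x *v axis i 1) \<bullet> axis i 1 - (H y *v b i) \<bullet> b i - \<rho>2 r * c * c
        - \<delta> * (2 * (axis i 1 \<bullet> (axis i 1 :: real^'n)) + 2 * (b i \<bullet> b i)) \<le> 0"
      by (rule DERIV2_local_max(2))
    then show ?thesis by (simp add: nb c_def power2_eq_square inner_axis_axis algebra_simps)
  qed
  have e2: "(\<Sum>i\<in>UNIV. (e $ i)\<^sup>2) = 1"
    using ee by (simp add: inner_vec_def power2_eq_square)
  have "(\<Sum>i\<in>UNIV. (H x *v axis i 1) \<bullet> axis i 1 - (H y *v b i) \<bullet> b i - 4 * (e $ i)\<^sup>2 * \<rho>2 r - 4 * \<delta>) \<le> 0"
    using dir by (intro sum_nonpos) auto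
  moreover have "(\<Sum>i\<in>UNIV. (H y *v b i) \<bullet> b i) = trace (H y)"
    unfolding b_def by (rule sum_reflected_axes[OF e])
  ultimately have "trace (H x) - trace (H y) - 4 * (\<Sum>i\<in>UNIV. (e $ i)\<^sup>2) * \<rho>2 r - 4 * real CARD('n) * \<delta> \<le> 0"
    unfolding trace_eq_sum_axis[of "H x"]
    by (simp add: sum_subtractf sum_distrib_left sum_distrib_right mult.assoc mult.commute mult.left_commute)
  then have "trace (H x) - trace (H y) \<le> 4 * \<rho>2 r + \<epsilon>" using \<delta>n e2 by simp
  moreover have "norm (g x - \<rho>1 r *\<^sub>R e) \<le> \<epsilon>" "norm (g y - \<rho>1 r *\<^sub>R e) \<le> \<epsilon>"
    using dx dy \<delta> by (auto simp: gx gy)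
  ultimately show thesis using that[OF r_def r0 rR e] by blast
qed

text \<open>Two-point comparison with the concave modulus \<open>\<mu> (2 t - t\<^sup>2)\<close> on
  \<open>[0, 1]\<close>; at larger distances the bound \<open>B\<close> on the oscillation
  suffices.\<close>

lemma Lipschitz_of_bounded_Laplacian:
  fixes w :: "real^'n::finite \<Rightarrow> real"
  assumes w: "\<And>x. jet2 w g (H x) x"
    and B: "\<And>x y. w x - w y \<le> B"
    and C: "\<And>x. \<bar>trace (H x)\<bar> \<le> C"
  shows "\<exists>K. \<forall>x y. \<bar>w x - w y\<bar> \<le> K * norm (x - y)"
proof -
  \<comment> \<open>\<open>\<mu> \<ge> B\<close> makes the modulus reach \<open>B\<close> at
    distance 1, and \<open>\<mu> \<ge> C + 1\<close> makes \<open>- 8 \<mu> + 1\<close> smaller than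
    any possible difference \<open>- 2 C\<close> of traces.\<close>
  define \<mu> where "\<mu> = max B (C + 1)"
  have C0: "C \<ge> 0" using C[of 0] by linarith
  have \<mu>: "\<mu> \<ge> B" "\<mu> \<ge> C + 1" by (auto simp: \<mu>_def)
  let ?\<rho> = "\<lambda>t. \<mu> * (2 * t - t\<^sup>2)"
  have "w x - w y \<le> 2 * \<mu> * norm (x - y)" for x y
  proof (cases "norm (x - y) \<le> 1")
    case True
    have "w x - w y \<le> ?\<rho> (norm (x - y))"
    proof (rule ccontr)
      assume "\<not> ?thesis"
      then have v: "w x - w y > ?\<rho> (norm (x - y))" by simp
      have \<rho>: "0 \<le> ?\<rho> t" if "0 \<le> t" "t \<le> 1" for t
      proof -
        have "t\<^sup>2 \<le> t" using that by (simp add: power2_eq_square mult_left_le)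
        then show ?thesis using that \<mu> C0 by simp
      qed
      show False
      proof (rule two_point_maximum[of w g H B ?\<rho> 1 "\<lambda>t. \<mu> * (2 - 2 * t)" "\<lambda>t. - 2 * \<mu>" x y 1])
        show "B \<le> \<mu> * (2 * 1 - 1\<^sup>2)" using \<mu> by simp
        show "(?\<rho> has_real_derivative \<mu> * (2 - 2 * t)) (at t)"
          "((\<lambda>t. \<mu> * (2 - 2 * t)) has_real_derivative - 2 * \<mu>) (at t)" for t
          by (auto intro!: derivative_eq_intros)
        show "continuous_on {0..1} ?\<rho>" by (intro continuous_intros)
      next
        fix x y
        assume "trace (H x) - trace (H y) \<le> 4 * (- 2 * \<mu>) + 1"
        then show False using C[of x] C[of y] \<mu> C0 by linarith
      qed (use w B \<rho> True v in simp_all)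
    qed
    also have "\<dots> \<le> 2 * \<mu> * norm (x - y)" using \<mu> C0 by (simp add: algebra_simps)
    finally show ?thesis .
  next
    case False
    have "\<mu> * 1 \<le> \<mu> * (2 * norm (x - y))"
      by (rule mult_left_mono) (use \<mu> C0 False in auto)
    then show ?thesis using B[of x y] \<mu> by simp
  qed
  then have "\<bar>w x - w y\<bar> \<le> 2 * \<mu> * norm (x - y)" for x y
    by (metis abs_le_iff minus_diff_eq norm_minus_commute)
  then show ?thesis by blast
qed

text \<open>The one-sided derivative at \<open>x\<close> in the direction \<open>g\<close> itself
  gives \<open>g \<bullet> g \<le> K * norm g\<close>.\<close>

lemma norm_gradient_le:
  fixes f :: "'a::real_inner \<Rightarrow> real"
  assumes f: "(f has_derivative (\<lambda>h. g \<bullet> h)) (at x)"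
    and K: "0 \<le> K"
    and le: "\<forall>\<^sub>F y in nhds x. f y - f x \<le> K * norm (y - x)"
  shows "norm g \<le> K"
proof (cases "g = 0")
  case True
  then show ?thesis using K by simp
next
  case False
  let ?l = "\<lambda>t::real. x + t *\<^sub>R g"
  have "(?l has_derivative (\<lambda>t. t *\<^sub>R g)) (at 0)" by (auto intro!: derivative_eq_intros)
  moreover have "(f has_derivative (\<lambda>h. g \<bullet> h)) (at (?l 0))" using f by simp
  ultimately have "((\<lambda>t. f (?l t)) has_derivative (\<lambda>t. g \<bullet> (t *\<^sub>R g))) (at 0)"
    by (rule has_derivative_compose)
  then have "((\<lambda>t. f (?l t)) has_real_derivative g \<bullet> g) (at 0)"
    by (simp add: has_field_derivative_def mult.commute[of _ "_ \<bullet> _"])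
  then have lim: "((\<lambda>t. (f (?l t) - f x) / t) \<longlongrightarrow> g \<bullet> g) (at_right 0)"
    unfolding has_field_derivative_iff by (auto intro: filterlim_mono simp: at_le)
  have "(?l \<longlongrightarrow> x) (at_right 0)" by (auto intro!: tendsto_eq_intros)
  then have "\<forall>\<^sub>F t in at_right 0. f (?l t) - f x \<le> K * norm (?l t - x)"
    by (rule eventually_compose_filterlim[OF le])
  then have "\<forall>\<^sub>F t in at_right 0. (f (?l t) - f x) / t \<le> K * norm g"
    using eventually_at_right_less[of 0] by eventually_elim (simp add: field_simps)
  then have "g \<bullet> g \<le> K * norm g"
    by (rule tendsto_upperbound[OF lim]) simp
  then show ?thesis using False by (simp add: power2_norm_eq_inner[symmetric] power2_eq_square)
qed

lemma Lipschitz_of_gradient: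
  fixes f :: "real^'n::finite \<Rightarrow> real"
  assumes "\<And>x. (f has_derivative (\<lambda>h. g x \<bullet> h)) (at x)" "\<And>x. norm (g x) \<le> K"
  shows "\<bar>f x - f y\<bar> \<le> K * norm (x - y)"
proof -
  have "norm (f x - f y) \<le> K * norm (x - y)"
    by (rule differentiable_bound[of UNIV f "\<lambda>x h. g x \<bullet> h"]) (use assms in \<open>auto intro!: onorm_le order_trans[OF Cauchy_Schwarz_ineq2] mult_right_mono\<close>)
  then show ?thesis by simp
qed

section \<open>The Modica gradient estimate\<close>

lemma antiderivative_exists:
  fixes f :: "real \<Rightarrow> real"
  assumes "\<And>s. isCont f s"
  shows "\<exists>\<Phi>. \<forall>s. (\<Phi> has_real_derivative f s) (at s)"
  using einterval_antiderivative[of "-\<infinity>" \<infinity> f] assms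
  by (simp add: has_real_derivative_iff_has_vector_derivative)

lemma MVT_bounds:
  fixes f f' :: "real \<Rightarrow> real"
  assumes "s \<le> t" and der: "\<And>z. s \<le> z \<Longrightarrow> z \<le> t \<Longrightarrow> (f has_real_derivative f' z) (at z)"
  shows "(\<And>z. s \<le> z \<Longrightarrow> z \<le> t \<Longrightarrow> f' z \<le> K) \<Longrightarrow> f t - f s \<le> K * (t - s)"
    and "(\<And>z. s \<le> z \<Longrightarrow> z \<le> t \<Longrightarrow> K \<le> f' z) \<Longrightarrow> K * (t - s) \<le> f t - f s"
proof -
  have ex: "\<exists>z\<ge>s. z \<le> t \<and> f t - f s = (t - s) * f' z"
  proof (cases "s = t")
    case False
    with \<open>s \<le> t\<close> have "s < t" by simp
    from MVT2[OF this der] show ?thesis by (meson less_imp_le)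
  qed auto
  then obtain z where z: "s \<le> z" "z \<le> t" "f t - f s = (t - s) * f' z" by blast
  show "f t - f s \<le> K * (t - s)" if "\<And>z. s \<le> z \<Longrightarrow> z \<le> t \<Longrightarrow> f' z \<le> K"
    using z that[of z] \<open>s \<le> t\<close> mult_left_mono[of "f' z" K "t - s"] by (simp add: mult.commute)
  show "K * (t - s) \<le> f t - f s" if "\<And>z. s \<le> z \<Longrightarrow> z \<le> t \<Longrightarrow> K \<le> f' z"
    using z that[of z] \<open>s \<le> t\<close> mult_left_mono[of K "f' z" "t - s"] by (simp add: mult.commute)
qed

text \<open>The profile is tuned so that, when the Laplacian of \<open>u\<close> equals
  \<open>F' / 2\<close>, the trace is a multiple of \<open>1 - |Dw|\<^sup>2\<close> for
  \<open>w = \<Phi>(u)\<close>.\<close>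

lemma jet2_profile:
  fixes u :: "real^'n::finite \<Rightarrow> real"
  assumes u: "jet2 u g H x"
    and \<Phi>: "\<forall>\<^sub>F s in nhds (u x). (\<Phi> has_real_derivative 1 / sqrt (F s)) (at s)"
    and F: "(F has_real_derivative F') (at (u x))" and pos: "F (u x) > 0"
  shows "\<exists>H'. jet2 (\<lambda>y. \<Phi> (u y)) (\<lambda>y. (1 / sqrt (F (u y))) *\<^sub>R g y) H' x \<and>
    trace H' = (trace H - F' / 2 * (norm ((1 / sqrt (F (u x))) *\<^sub>R g x))\<^sup>2) / sqrt (F (u x))"
proof -
  have d: "((\<lambda>s. 1 / sqrt (F s)) has_real_derivative - F' / (2 * F (u x) * sqrt (F (u x)))) (at (u x))"
    using F pos by (auto intro!: derivative_eq_intros simp: field_simps)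
  show ?thesis
  proof (rule exI, rule conjI[OF jet2_compose[OF u \<Phi> d]])
    show "trace (\<chi> i j. 1 / sqrt (F (u x)) * H $ i $ j + - F' / (2 * F (u x) * sqrt (F (u x))) * g x $ i * g x $ j)
      = (trace H - F' / 2 * (norm ((1 / sqrt (F (u x))) *\<^sub>R g x))\<^sup>2) / sqrt (F (u x))"
      unfolding trace_compose norm_scaleR using pos
      by (simp add: power_mult_distrib power_divide field_simps)
  qed
qed

text \<open>
  With \<open>\<kappa> = sup (|Du|\<^sup>2 - 2 W(u)) > 0\<close> the function \<open>w = \<Phi>(u)\<close>, \<open>\<Phi>' = (2 W + \<kappa>)\<^bsup>-1/2\<^esup>\<close>, is
  bounded with optimal Lipschitz constant 1, and \<open>\<Delta>w = J(u) (1 - |Dw|\<^sup>2)\<close>. Comparing \<open>w(x) - w(y)\<close>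
  with a modulus \<open>\<rho>\<close> of slope slightly below 1, concave enough to beat the Lipschitz constant
  of \<open>J \<circ> u\<close>, improves that constant.
\<close>

lemma modica_estimate:
  fixes u :: "real^'n::finite \<Rightarrow> real"
  assumes u: "\<And>x. jet2 u g (H x) x"
    and bnd: "\<And>x. lo \<le> u x" "\<And>x. u x \<le> hi"
    and W: "\<And>s. (W has_real_derivative W' s) (at s)"
    and W0: "\<And>s. 0 \<le> W s"
    and L: "\<And>s t. s \<in> {lo..hi} \<Longrightarrow> t \<in> {lo..hi} \<Longrightarrow> \<bar>W' s - W' t\<bar> \<le> L * \<bar>s - t\<bar>"
    and eq: "\<And>x. trace (H x) = W' (u x)"
  shows "(norm (g x))\<^sup>2 \<le> 2 * W (u x)"
proof -
  have lohi: "lo \<le> hi" using bnd[of 0] by linarith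
  define C where "C = \<bar>W' lo\<bar> + \<bar>L\<bar> * (hi - lo)"
  have C: "\<bar>W' s\<bar> \<le> C" if "s \<in> {lo..hi}" for s
  proof -
    have "\<bar>W' s - W' lo\<bar> \<le> L * \<bar>s - lo\<bar>" using L[OF that] lohi by simp
    also have "\<dots> \<le> \<bar>L\<bar> * (hi - lo)" using that by (intro mult_mono) auto
    finally show ?thesis by (simp add: C_def)
  qed
  have C0: "C \<ge> 0" using C[of lo] lohi by simp
  obtain K where K: "\<And>x y. \<bar>u x - u y\<bar> \<le> K * norm (x - y)"
  proof -
    have "\<exists>K. \<forall>x y. \<bar>u x - u y\<bar> \<le> K * norm (x - y)"
    proof (rule Lipschitz_of_bounded_Laplacian[OF u])
      show "u x - u y \<le> hi - lo" for x y using bnd[of x] bnd[of y] by linarith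
      show "\<bar>trace (H x)\<bar> \<le> C" for x unfolding eq using C bnd by simp
    qed
    then show thesis using that by blast
  qed
  define K' where "K' = \<bar>K\<bar>"
  have K': "\<bar>u x - u y\<bar> \<le> K' * norm (x - y)" "K' \<ge> 0" for x y
    using order_trans[OF K[of x y] mult_right_mono[of K K' "norm (x - y)"]] by (auto simp: K'_def)
  have gK: "norm (g x) \<le> K'" for x
    by (rule norm_gradient_le[OF jet2_has_derivative[OF u] K'(2)])
       (use K'(1) in \<open>auto intro: always_eventually simp: abs_le_iff\<close>)
  \<comment> \<open>The Lipschitz bound is used only here, to make the supremum of \<open>P\<close>
    finite.\<close>
  define P where "P = (\<lambda>x. (norm (g x))\<^sup>2 - 2 * W (u x))"
  define \<kappa> where "\<kappa> = (SUP x. P x)"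
  have "P x \<le> K'\<^sup>2" for x
    using power_mono[OF gK[of x], of 2] W0[of "u x"] by (simp add: P_def)
  then have bdd: "bdd_above (range P)" by (rule bdd_aboveI2)
  have P\<kappa>: "P x \<le> \<kappa>" for x unfolding \<kappa>_def by (rule cSUP_upper[OF _ bdd]) simp
  have "\<kappa> \<le> 0"
  proof (rule ccontr)
    assume "\<not> \<kappa> \<le> 0"
    then have \<kappa>: "\<kappa> > 0" by simp
    define F where "F = (\<lambda>s. 2 * W s + \<kappa>)"
    have F\<kappa>: "F s \<ge> \<kappa>" for s using W0[of s] by (simp add: F_def)
    have Fpos: "F s > 0" for s using F\<kappa>[of s] \<kappa> by simp
    have dF: "(F has_real_derivative 2 * W' s) (at s)" for s
      unfolding F_def by (auto intro!: derivative_eq_intros W)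
    have dq: "((\<lambda>s. 1 / sqrt (F s)) has_real_derivative - W' s / (F s * sqrt (F s))) (at s)" for s
      using dF[of s] Fpos[of s] by (auto intro!: derivative_eq_intros simp: field_simps)
    obtain \<Phi> where \<Phi>: "\<And>s. (\<Phi> has_real_derivative 1 / sqrt (F s)) (at s)"
      using antiderivative_exists[of "\<lambda>s. 1 / sqrt (F s)"] DERIV_isCont[OF dq] by blast
    define w where "w = (\<lambda>x. \<Phi> (u x))"
    define G where "G = (\<lambda>x. (1 / sqrt (F (u x))) *\<^sub>R g x)"
    define J where "J = (\<lambda>s. W' s / sqrt (F s))"
    have "\<exists>H'. jet2 w G H' x \<and> trace H' = J (u x) * (1 - (norm (G x))\<^sup>2)" for x
      using jet2_profile[OF u _ dF Fpos, of \<Phi> x] \<Phi>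
      by (simp add: w_def G_def J_def eq algebra_simps diff_divide_distrib)
    then obtain H' where H': "\<And>x. jet2 w G (H' x) x" "\<And>x. trace (H' x) = J (u x) * (1 - (norm (G x))\<^sup>2)"
      by metis
    have nG: "(norm (G x))\<^sup>2 = (norm (g x))\<^sup>2 / F (u x)" for x
      using Fpos[of "u x"] by (simp add: G_def power_mult_distrib power_divide)
    \<comment> \<open>This is the definition of \<open>\<kappa>\<close> as a supremum, rewritten for
      \<open>w\<close>.\<close>
    have G1: "norm (G x) \<le> 1" for x
    proof -
      have "(norm (g x))\<^sup>2 \<le> F (u x)" using P\<kappa>[of x] by (simp add: P_def F_def)
      then have "(norm (G x))\<^sup>2 \<le> 1\<^sup>2" using Fpos[of "u x"] by (simp add: nG)
      then show ?thesis by (rule power2_le_imp_le) simp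
    qed
    have rt: "1 / sqrt (F s) \<le> 1 / sqrt \<kappa>" "1 / sqrt (F s) > 0" for s
      using F\<kappa>[of s] Fpos[of s] \<kappa> by (auto intro!: divide_left_mono)
    \<comment> \<open>Product rule for \<open>J = W' / sqrt F\<close>: the factor
      \<open>1 / sqrt F\<close> is bounded and Lipschitz because
      \<open>F \<ge> \<kappa> > 0\<close>.\<close>
    define L1 where "L1 = \<bar>L\<bar> / sqrt \<kappa> + C * (C / (\<kappa> * sqrt \<kappa>))"
    have L1: "\<bar>J s - J t\<bar> \<le> L1 * \<bar>s - t\<bar>" if st: "s \<in> {lo..hi}" "t \<in> {lo..hi}" for s t
    proof -
      have "norm (1 / sqrt (F s) - 1 / sqrt (F t)) \<le> C / (\<kappa> * sqrt \<kappa>) * norm (s - t)"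
      proof (rule field_differentiable_bound[OF convex_closed_interval[of lo hi]])
        show "((\<lambda>s. 1 / sqrt (F s)) has_field_derivative - W' z / (F z * sqrt (F z))) (at z within {lo..hi})" for z
          by (rule DERIV_subset[OF dq]) simp
        show "norm (- W' z / (F z * sqrt (F z))) \<le> C / (\<kappa> * sqrt \<kappa>)" if "z \<in> {lo..hi}" for z
          using C[OF that] F\<kappa>[of z] Fpos[of z] \<kappa> by (auto simp: abs_mult intro!: frac_le mult_mono)
      qed (use st in auto)
      then have q: "\<bar>1 / sqrt (F s) - 1 / sqrt (F t)\<bar> \<le> C / (\<kappa> * sqrt \<kappa>) * \<bar>s - t\<bar>" by simp
      have "J s - J t = (W' s - W' t) * (1 / sqrt (F s)) + W' t * (1 / sqrt (F s) - 1 / sqrt (F t))"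
        by (simp add: J_def algebra_simps diff_divide_distrib)
      also have "\<bar>\<dots>\<bar> \<le> \<bar>W' s - W' t\<bar> * (1 / sqrt (F s)) + \<bar>W' t\<bar> * \<bar>1 / sqrt (F s) - 1 / sqrt (F t)\<bar>"
        using rt(2)[of s] by (intro order_trans[OF abs_triangle_ineq]) (simp add: abs_mult)
      also have "\<dots> \<le> (\<bar>L\<bar> * \<bar>s - t\<bar>) * (1 / sqrt \<kappa>) + C * (C / (\<kappa> * sqrt \<kappa>) * \<bar>s - t\<bar>)"
      proof (intro add_mono mult_mono)
        show "\<bar>W' s - W' t\<bar> \<le> \<bar>L\<bar> * \<bar>s - t\<bar>"
          by (rule order_trans[OF L[OF st] mult_right_mono]) auto
      qed (use rt[of s] C[OF st(2)] q C0 in auto)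
      finally show ?thesis by (simp add: L1_def algebra_simps)
    qed
    have L1p: "L1 \<ge> 0" using C0 \<kappa> by (simp add: L1_def)
    define L2 where "L2 = L1 * K'"
    have L2p: "L2 \<ge> 0" using L1p K'(2) by (simp add: L2_def)
    have L2: "\<bar>J (u x) - J (u y)\<bar> \<le> L2 * norm (x - y)" for x y
    proof -
      have "\<bar>J (u x) - J (u y)\<bar> \<le> L1 * \<bar>u x - u y\<bar>" by (rule L1) (use bnd in auto)
      also have "\<dots> \<le> L1 * (K' * norm (x - y))" by (rule mult_left_mono[OF K'(1) L1p])
      finally show ?thesis by (simp add: L2_def mult.assoc)
    qed
    define J0 where "J0 = C / sqrt \<kappa>"
    have J0: "\<bar>J (u x)\<bar> \<le> J0" for x
      unfolding J_def J0_def using C[of "u x"] bnd[of x] F\<kappa>[of "u x"] Fpos[of "u x"] \<kappa> C0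
      by (auto intro!: frac_le)
    have J0p: "J0 \<ge> 0" using C0 \<kappa> by (simp add: J0_def)
    define B where "B = \<Phi> hi - \<Phi> lo"
    have mono: "\<Phi> s \<le> \<Phi> t" if "s \<le> t" for s t
      by (rule DERIV_nonneg_imp_nondecreasing[OF that]) (use \<Phi> rt(2) in \<open>meson less_imp_le\<close>)
    have B: "w x - w y \<le> B" for x y
      using mono[OF bnd(1)[of y]] mono[OF bnd(2)[of x]] by (simp add: w_def B_def)
    have B0: "B \<ge> 0" using mono[OF lohi] by (simp add: B_def)
    \<comment> \<open>The modulus below satisfies \<open>\<rho> t \<ge> t / 2\<close> on
      \<open>[0, R]\<close>, so this length makes \<open>\<rho> R\<close> exceed the oscillation
      \<open>B\<close> of \<open>w\<close>.\<close>
    define R where "R = 2 * B + 1"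
    define c where "c = L2 * R + 1"
    have R: "R > 0" using B0 by (simp add: R_def)
    have c: "c \<ge> 1" using L2p R by (simp add: c_def)
    \<comment> \<open>On \<open>[0, R]\<close> the slope of the modulus then stays between
      \<open>1 / 2\<close> and \<open>1 - \<eta>\<close>.\<close>
    define \<eta> where "\<eta> = exp (- c * R) / 2"
    have \<eta>: "\<eta> > 0" by (simp add: \<eta>_def)
    have \<eta>e: "\<eta> * exp (c * t) \<le> 1 / 2" if "t \<le> R" for t
      using that c by (simp add: \<eta>_def exp_add[symmetric] divide_le_eq)
    define \<rho> where "\<rho> = (\<lambda>t. t - \<eta> * (exp (c * t) - 1) / c)"
    define \<rho>1 where "\<rho>1 = (\<lambda>t. 1 - \<eta> * exp (c * t))"
    define \<rho>2 where "\<rho>2 = (\<lambda>t. - \<eta> * c * exp (c * t))"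
    have \<rho>lo: "\<rho> t \<ge> t / 2" if "0 \<le> t" "t \<le> R" for t
    proof -
      have "1 - c * t \<le> exp (- (c * t))" using exp_ge_add_one_self[of "- (c * t)"] by simp
      then have "(1 - c * t) * exp (c * t) \<le> exp (- (c * t)) * exp (c * t)" by (rule mult_right_mono) simp
      then have "exp (c * t) - 1 \<le> c * t * exp (c * t)" by (simp add: algebra_simps exp_add[symmetric])
      then have "\<eta> * (exp (c * t) - 1) \<le> \<eta> * (c * t * exp (c * t))" using \<eta> by (intro mult_left_mono) auto
      also have "\<dots> = (\<eta> * exp (c * t)) * (c * t)" by simp
      also have "\<dots> \<le> 1 / 2 * (c * t)" using \<eta>e[OF that(2)] c that by (intro mult_right_mono) auto
      finally show ?thesis using c by (simp add: \<rho>_def field_simps)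
    qed
    have \<rho>up: "\<rho> t \<le> (1 - \<eta>) * t" for t
    proof -
      have "\<eta> * (c * t) \<le> \<eta> * (exp (c * t) - 1)"
      proof (rule mult_left_mono)
        show "c * t \<le> exp (c * t) - 1" using exp_ge_add_one_self[of "c * t"] by linarith
      qed (use \<eta> in simp)
      then show ?thesis using c by (simp add: \<rho>_def field_simps)
    qed
    \<comment> \<open>A point almost attaining the supremum \<open>\<kappa>\<close>: there
      \<open>|Du|\<^sup>2 = 2 W + P\<close> exceeds
      \<open>(1 - \<eta>)\<^sup>2 (2 W + \<kappa>)\<close>.\<close>
    have "\<exists>x. norm (G x) > 1 - \<eta>"
    proof -
      have \<eta>1: "\<eta> \<le> 1 / 2" using \<eta>e[of 0] R by simp
      have "\<eta> * (2 - \<eta>) > 0" using \<eta> \<eta>1 by simp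
      then have "(1 - \<eta>)\<^sup>2 < 1" by (simp add: power2_eq_square algebra_simps)
      then have "\<kappa> * (1 - \<eta>)\<^sup>2 < \<kappa>" using \<kappa> by simp
      then obtain x where x: "\<kappa> * (1 - \<eta>)\<^sup>2 < P x"
        unfolding \<kappa>_def using less_cSUP_iff[OF _ bdd] by auto
      have "(1 - \<eta>)\<^sup>2 * F (u x) = (1 - \<eta>)\<^sup>2 * (2 * W (u x)) + \<kappa> * (1 - \<eta>)\<^sup>2" by (simp add: F_def algebra_simps)
      also have "\<dots> < 1 * (2 * W (u x)) + P x"
        using x \<open>(1 - \<eta>)\<^sup>2 < 1\<close> W0[of "u x"] by (intro add_le_less_mono mult_right_mono) auto
      also have "\<dots> = (norm (g x))\<^sup>2" by (simp add: P_def)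
      finally have "(1 - \<eta>)\<^sup>2 < (norm (G x))\<^sup>2" using Fpos[of "u x"] by (simp add: nG field_simps)
      then have "1 - \<eta> < norm (G x)" by (rule power2_less_imp_less) simp
      then show ?thesis by blast
    qed
    then obtain z where z: "norm (G z) > 1 - \<eta>" by blast
    \<comment> \<open>If the modulus were respected everywhere, its slope at most
      \<open>1 - \<eta>\<close> would bound the gradient at \<open>z\<close>.\<close>
    have "\<exists>x y. norm (x - y) \<le> R \<and> w x - w y > \<rho> (norm (x - y))"
    proof (rule ccontr)
      assume "\<not> ?thesis"
      then have le: "w x - w y \<le> \<rho> (norm (x - y))" if "norm (x - y) \<le> R" for x y
        using that by (meson not_le)
      have "norm (G z) \<le> 1 - \<eta>"
      proof (rule norm_gradient_le[OF jet2_has_derivative[OF H'(1)]])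
        show "0 \<le> 1 - \<eta>" using \<eta>e[of 0] R by simp
        have "\<forall>\<^sub>F y in nhds z. dist y z < R" using R unfolding eventually_nhds_metric by blast
        then show "\<forall>\<^sub>F y in nhds z. w y - w z \<le> (1 - \<eta>) * norm (y - z)"
        proof eventually_elim
          case (elim y)
          then show ?case using order_trans[OF le[of y z] \<rho>up[of "norm (y - z)"]] by (simp add: dist_norm)
        qed
      qed
      then show False using z by simp
    qed
    then obtain x0 y0 where v: "norm (x0 - y0) \<le> R" "w x0 - w y0 > \<rho> (norm (x0 - y0))" by blast
    define \<epsilon> where "\<epsilon> = min 1 (\<eta> / (1 + 6 * J0))"
    have \<epsilon>: "\<epsilon> > 0" "\<epsilon> \<le> 1" using \<eta> J0p by (auto simp: \<epsilon>_def)
    have "\<epsilon> \<le> \<eta> / (1 + 6 * J0)" by (simp add: \<epsilon>_def)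
    then have \<epsilon>\<eta>: "\<epsilon> * (1 + 6 * J0) \<le> \<eta>" using J0p by (simp add: field_simps)
    show False
    proof (rule two_point_maximum[of w G H' B \<rho> R \<rho>1 \<rho>2 x0 y0 \<epsilon>])
      show "B \<le> \<rho> R" using \<rho>lo[of R] R by (simp add: R_def)
      show "0 \<le> \<rho> t" if "0 \<le> t" "t \<le> R" for t using \<rho>lo[OF that] that by simp
      show "continuous_on {0..R} \<rho>" unfolding \<rho>_def using c by (intro continuous_intros) auto
      show "(\<rho> has_real_derivative \<rho>1 t) (at t)" for t
        unfolding \<rho>_def \<rho>1_def using c by (auto intro!: derivative_eq_intros)
      show "(\<rho>1 has_real_derivative \<rho>2 t) (at t)" for t
        unfolding \<rho>1_def \<rho>2_def by (auto intro!: derivative_eq_intros)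
    next
      fix x y :: "real^'n" and r :: real and e :: "real^'n"
      assume r: "r = norm (x - y)" "0 < r" "r < R" and e: "norm e = 1"
        and gx: "norm (G x - \<rho>1 r *\<^sub>R e) \<le> \<epsilon>" and gy: "norm (G y - \<rho>1 r *\<^sub>R e) \<le> \<epsilon>"
        and tr: "trace (H' x) - trace (H' y) \<le> 4 * \<rho>2 r + \<epsilon>"
      \<comment> \<open>\<open>E\<close> is the slope deficit at distance \<open>r\<close>.
        Lipschitz continuity of \<open>J \<circ> u\<close> costs at most
        \<open>2 * (c - 1) * E\<close> in the traces, whereas the concavity of the modulus provides
        \<open>4 * c * E\<close>.\<close>
      define E where "E = \<eta> * exp (c * r)"
      have E: "E \<ge> \<eta>" "E \<le> 1 / 2" using \<eta>e[of r] r c \<eta> by (auto simp: E_def)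
      have p: "\<rho>1 r = 1 - E" by (simp add: \<rho>1_def E_def)
      have near: "\<bar>(norm (G q))\<^sup>2 - (1 - E)\<^sup>2\<bar> \<le> 3 * \<epsilon>" if "norm (G q - \<rho>1 r *\<^sub>R e) \<le> \<epsilon>" for q
      proof -
        have "\<bar>norm (G q) - (1 - E)\<bar> \<le> \<epsilon>"
          using order_trans[OF norm_triangle_ineq3 that] e E by (simp add: p)
        moreover have "\<bar>norm (G q) + (1 - E)\<bar> \<le> 3"
          using G1[of q] E \<eta> by simp
        ultimately have "\<bar>norm (G q) - (1 - E)\<bar> * \<bar>norm (G q) + (1 - E)\<bar> \<le> \<epsilon> * 3"
          by (intro mult_mono) auto
        then show ?thesis by (simp add: abs_mult[symmetric] power2_eq_square algebra_simps)
      qed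
      define a b where "a = 1 - (norm (G x))\<^sup>2 - (1 - (1 - E)\<^sup>2)" and "b = 1 - (norm (G y))\<^sup>2 - (1 - (1 - E)\<^sup>2)"
      have ab: "\<bar>a\<bar> \<le> 3 * \<epsilon>" "\<bar>b\<bar> \<le> 3 * \<epsilon>" using near[OF gx] near[OF gy] by (auto simp: a_def b_def)
      have "\<bar>J (u x) * a\<bar> \<le> J0 * (3 * \<epsilon>)" "\<bar>J (u y) * b\<bar> \<le> J0 * (3 * \<epsilon>)"
        unfolding abs_mult using J0 ab J0p by (auto intro!: mult_mono)
      moreover have "\<bar>(J (u x) - J (u y)) * (1 - (1 - E)\<^sup>2)\<bar> \<le> L2 * R * (2 * E)"
      proof -
        have "\<bar>J (u x) - J (u y)\<bar> \<le> L2 * R"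
          using L2[of x y] r L2p mult_left_mono[of r R L2] by simp
        moreover have "\<bar>1 - (1 - E)\<^sup>2\<bar> \<le> 2 * E"
        proof -
          have "1 - (1 - E)\<^sup>2 = E * (2 - E)" by (simp add: power2_eq_square algebra_simps)
          moreover have "0 \<le> E * (2 - E)" "E * (2 - E) \<le> E * 2"
            using E \<eta> by (auto intro: mult_nonneg_nonneg mult_left_mono)
          ultimately show ?thesis by simp
        qed
        ultimately show ?thesis unfolding abs_mult using L2p R by (intro mult_mono) auto
      qed
      moreover have "trace (H' x) - trace (H' y)
          = (J (u x) - J (u y)) * (1 - (1 - E)\<^sup>2) + J (u x) * a - J (u y) * b"
        unfolding H'(2) a_def b_def by (simp add: algebra_simps)
      ultimately have "- (L2 * R * (2 * E)) - 6 * J0 * \<epsilon> \<le> 4 * \<rho>2 r + \<epsilon>" using tr by linarith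
      moreover have "\<rho>2 r = - c * E" by (simp add: \<rho>2_def E_def)
      ultimately have "4 * c * E - 2 * (L2 * R) * E \<le> \<epsilon> * (1 + 6 * J0)" by (simp add: algebra_simps)
      moreover have "L2 * R = c - 1" by (simp add: c_def)
      ultimately have "2 * c * E + 2 * E \<le> \<eta>" using \<epsilon>\<eta> by (simp add: algebra_simps)
      moreover have "c * E \<ge> 1 * E" using c E \<eta> by (intro mult_right_mono) auto
      ultimately show False using E \<eta> by linarith
    qed (use H' B v \<epsilon> in auto)
  qed
  then show ?thesis using P\<kappa>[of x] by (simp add: P_def)
qed

section \<open>Exponential decay and a quantitative strong maximum principle\<close>

lemma jet2_cmult:
  assumes "jet2 f g H x"
  shows "\<exists>H'. jet2 (\<lambda>y. c * f y) (\<lambda>y. c *\<^sub>R g y) H' x \<and> trace H' = c * trace H"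
proof -
  have "jet2 (\<lambda>y. c * f y) (\<lambda>y. c *\<^sub>R g y) (\<chi> i j. c * H $ i $ j + 0 * g x $ i * g x $ j) x"
    by (rule jet2_compose[OF assms, where \<phi>="\<lambda>s. c * s" and \<phi>'="\<lambda>_. c"])
       (auto intro!: derivative_eq_intros always_eventually)
  then show ?thesis using trace_compose[of c H 0 "g x"] by (intro exI conjI) auto
qed

text \<open>Gronwall on the segment from \<open>y\<close> to \<open>x\<close>: the gap
  \<open>b - u\<close>, damped by the exponential factor, is nonincreasing.\<close>

lemma exponential_decay:
  fixes u :: "real^'n::finite \<Rightarrow> real"
  assumes u: "\<And>x. (u has_derivative (\<lambda>h. g x \<bullet> h)) (at x)"
    and g: "\<And>x. norm (g x) \<le> k * (b - u x)"
  shows "b - u x \<le> (b - u y) * exp (k * norm (x - y))"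
proof -
  let ?n = "norm (x - y)"
  let ?l = "\<lambda>t. y + t *\<^sub>R (x - y)"
  let ?f = "\<lambda>t. (b - u (?l t)) * exp (- (k * ?n) * t)"
  have "?f 1 \<le> ?f 0"
  proof (rule DERIV_nonpos_imp_nonincreasing[where f="?f"])
    fix t :: real
    have "(?l has_derivative (\<lambda>s. s *\<^sub>R (x - y))) (at t)" by (auto intro!: derivative_eq_intros)
    from has_derivative_compose[OF this u]
    have d: "((\<lambda>t. u (?l t)) has_real_derivative g (?l t) \<bullet> (x - y)) (at t)"
      by (simp add: has_field_derivative_def mult.commute[of _ "_ \<bullet> _"])
    have e: "((\<lambda>t. exp (- (k * ?n) * t)) has_real_derivative exp (- (k * ?n) * t) * (- (k * ?n))) (at t)"
      by (auto intro!: derivative_eq_intros)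
    have fd: "(?f has_real_derivative (- (g (?l t) \<bullet> (x - y)) - k * ?n * (b - u (?l t))) * exp (- (k * ?n) * t)) (at t)"
      by (rule DERIV_cong[OF DERIV_mult[OF DERIV_diff[OF DERIV_const d] e]]) (simp add: algebra_simps)
    have "- (g (?l t) \<bullet> (x - y)) \<le> norm (g (?l t)) * ?n"
      using Cauchy_Schwarz_ineq2[of "g (?l t)" "x - y"] by linarith
    moreover have "norm (g (?l t)) * ?n \<le> k * (b - u (?l t)) * ?n" by (rule mult_right_mono[OF g]) simp
    ultimately have "- (g (?l t) \<bullet> (x - y)) - k * ?n * (b - u (?l t)) \<le> 0" by (simp add: algebra_simps)
    then have "(- (g (?l t) \<bullet> (x - y)) - k * ?n * (b - u (?l t))) * exp (- (k * ?n) * t) \<le> 0"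
      by (simp add: mult_le_0_iff)
    with fd show "\<exists>d. (?f has_real_derivative d) (at t) \<and> d \<le> 0" by blast
  qed simp
  then have "(b - u x) * exp (- (k * ?n)) \<le> b - u y" by simp
  then have "(b - u x) * exp (- (k * ?n)) * exp (k * ?n) \<le> (b - u y) * exp (k * ?n)" by (rule mult_right_mono) simp
  then show ?thesis by (simp add: mult.assoc exp_add[symmetric])
qed

section \<open>Pointwise bounds on the potential\<close>

lemma quadratic_upper_bound:
  fixes W W' :: "real \<Rightarrow> real"
  assumes W: "\<And>s. (W has_real_derivative W' s) (at s)" and b: "W b = 0" "W' b = 0"
    and "s \<le> b" and L: "\<And>t. s \<le> t \<Longrightarrow> t \<le> b \<Longrightarrow> \<bar>W' t - W' b\<bar> \<le> L * \<bar>t - b\<bar>" and "0 \<le> L"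
  shows "W s \<le> L * (b - s)\<^sup>2"
proof -
  have "- (L * (b - s)) * (b - s) \<le> W b - W s"
  proof (rule MVT_bounds(2)[OF \<open>s \<le> b\<close> W])
    fix z assume z: "s \<le> z" "z \<le> b"
    have "L * \<bar>z - b\<bar> \<le> L * (b - s)" using z \<open>0 \<le> L\<close> by (intro mult_left_mono) auto
    then show "- (L * (b - s)) \<le> W' z" using L[OF z] b by linarith
  qed
  then show ?thesis using b by (simp add: power2_eq_square)
qed

text \<open>A nonnegative function with Lipschitz derivative has small slope where it is small: a
  step against the slope would otherwise make it negative. This bounds
  \<open>W' / sqrt (2 * W + \<kappa>)\<close> uniformly in \<open>\<kappa> > 0\<close>.\<close>

lemma derivative_sq_le:
  fixes W W' :: "real \<Rightarrow> real"
  assumes W: "\<And>s. (W has_real_derivative W' s) (at s)" and W0: "\<And>s. 0 \<le> W s"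
    and L: "\<And>s t. s \<in> {lo-1..hi+1} \<Longrightarrow> t \<in> {lo-1..hi+1} \<Longrightarrow> \<bar>W' s - W' t\<bar> \<le> L * \<bar>s - t\<bar>" and "0 \<le> L"
    and s: "s \<in> {lo..hi}"
  shows "(W' s)\<^sup>2 \<le> 2 * (2 * L + (\<bar>W' lo\<bar> + L * (hi - lo)) + 1) * W s"
proof -
  define C where "C = \<bar>W' lo\<bar> + L * (hi - lo)"
  have "\<bar>W' s - W' lo\<bar> \<le> L * \<bar>s - lo\<bar>" using s by (intro L) auto
  also have "\<dots> \<le> L * (hi - lo)" using s \<open>0 \<le> L\<close> by (intro mult_left_mono) auto
  finally have C: "\<bar>W' s\<bar> \<le> C" by (simp add: C_def)
  \<comment> \<open>\<open>M \<ge> \<bar>W' s\<bar>\<close> keeps the step \<open>\<tau>\<close>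
    below 1, inside the interval enlarged by 1; \<open>M \<ge> 2 * L\<close> lets the linear gain
    absorb the quadratic error.\<close>
  define M where "M = 2 * L + C + 1"
  have M: "M > 0" "\<bar>W' s\<bar> \<le> M" "2 * L \<le> M" using C \<open>0 \<le> L\<close> by (auto simp: M_def)
  define \<tau> where "\<tau> = W' s / M"
  have \<tau>: "\<bar>\<tau>\<bar> \<le> 1" using M by (simp add: \<tau>_def)
  have W's: "W' s = M * \<tau>" using M by (simp add: \<tau>_def)
  have lip: "\<bar>W' z - W' s\<bar> \<le> L * \<bar>\<tau>\<bar>" if "\<bar>z - s\<bar> \<le> \<bar>\<tau>\<bar>" for z
  proof -
    have "\<bar>W' z - W' s\<bar> \<le> L * \<bar>z - s\<bar>" by (rule L) (use s that \<tau> in auto)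
    also have "\<dots> \<le> L * \<bar>\<tau>\<bar>" by (rule mult_left_mono[OF that \<open>0 \<le> L\<close>])
    finally show ?thesis .
  qed
  have "W (s - \<tau>) \<le> W s - W' s * \<tau> + L * \<tau>\<^sup>2"
  proof (cases "\<tau> \<ge> 0")
    case True
    have "(W' s - L * \<tau>) * (s - (s - \<tau>)) \<le> W s - W (s - \<tau>)"
    proof (rule MVT_bounds(2)[OF _ W])
      fix z assume "s - \<tau> \<le> z" "z \<le> s"
      then show "W' s - L * \<tau> \<le> W' z" using lip[of z] True by auto
    qed (use True in simp)
    then show ?thesis by (simp add: power2_eq_square algebra_simps)
  next
    case False
    have "W (s - \<tau>) - W s \<le> (W' s - L * \<tau>) * ((s - \<tau>) - s)"
    proof (rule MVT_bounds(1)[OF _ W])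
      fix z assume "s \<le> z" "z \<le> s - \<tau>"
      then show "W' z \<le> W' s - L * \<tau>" using lip[of z] False by auto
    qed (use False in simp)
    then show ?thesis by (simp add: power2_eq_square algebra_simps)
  qed
  then have "0 \<le> W s - M * \<tau>\<^sup>2 + L * \<tau>\<^sup>2" using W0[of "s - \<tau>"] by (simp add: W's power2_eq_square)
  moreover have "2 * L * \<tau>\<^sup>2 \<le> M * \<tau>\<^sup>2" using M by (intro mult_right_mono) auto
  ultimately have "M * \<tau>\<^sup>2 \<le> 2 * W s" by linarith
  then have "M * (M * \<tau>\<^sup>2) \<le> M * (2 * W s)" using M by (intro mult_left_mono) auto
  then show ?thesis by (simp add: W's M_def[symmetric, unfolded C_def] M_def C_def power2_eq_square algebra_simps)
qed

text \<open>A Hopf barrier on the annulus \<open>1 / 8 \<le> norm (x - z) \<le> \<rho>\<close>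
  carries positivity of \<open>w - w q + norm (x - q)\<close> from \<open>z\<close> to
  \<open>p\<close>. The data are quantified inside the conclusion because \<open>c1\<close> and
  \<open>R0\<close> must be fixed before \<open>w\<close> is constructed.\<close>

lemma quantitative_strong_maximum:
  fixes K \<rho> :: real
  assumes "K \<ge> 0" "\<rho> > 1"
  obtains c1 R0 where "c1 > 0" "R0 > 0"
    "\<forall>(w :: real^'n::finite \<Rightarrow> real) G H A p q z. (\<forall>x. jet2 w G (H x) x) \<longrightarrow> (\<forall>x. norm (G x) \<le> 1) \<longrightarrow>
       (\<forall>x. trace (H x) = A x * (1 - (norm (G x))\<^sup>2)) \<longrightarrow> (\<forall>x. \<bar>A x\<bar> \<le> K) \<longrightarrow>
       norm (z - p) \<le> \<rho> - 1 \<longrightarrow> norm (q - p) \<ge> R0 \<longrightarrow> w z - w q + norm (z - q) \<ge> 1 / 2 \<longrightarrow>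
       w p - w q + norm (p - q) \<ge> c1"
proof -
  define n where "n = real CARD('n)"
  have n: "n \<ge> 1" by (simp add: n_def Suc_leI)
  \<comment> \<open>Large enough for the term \<open>4 \<alpha>\<^sup>2 r\<^sup>2\<close> to beat
    the terms linear in \<open>\<alpha>\<close> already at the inner radius
    \<open>1 / 8\<close>.\<close>
  define \<alpha> where "\<alpha> = 16 * (2 * n + 8 * K * \<rho> + 1)"
  have \<alpha>: "\<alpha> \<ge> 1" using n assms by (simp add: \<alpha>_def)
  \<comment> \<open>The value of the barrier \<open>v\<close> at distance \<open>\<rho> - 1\<close>
    from \<open>z\<close>.\<close>
  define c1 where "c1 = (exp (- \<alpha> * (\<rho> - 1)\<^sup>2) - exp (- \<alpha> * \<rho>\<^sup>2)) / 4"
  \<comment> \<open>So far from \<open>q\<close> the curvature term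
    \<open>(n - 1) / norm (x - q)\<close> is below
    \<open>exp (- \<alpha> * \<rho>\<^sup>2) / 4\<close>.\<close>
  define R0 where "R0 = 2 * \<rho> + 4 * n * exp (\<alpha> * \<rho>\<^sup>2)"
  have "(\<rho> - 1)\<^sup>2 < \<rho>\<^sup>2" using assms by (intro power_strict_mono) auto
  then have c1: "c1 > 0" using \<alpha> by (simp add: c1_def)
  have R0: "R0 > 0" using assms n by (simp add: R0_def add_pos_pos)
  show thesis
  proof (rule that[OF c1 R0], intro allI impI)
    fix w :: "real^'n \<Rightarrow> real" and G H A p q z
    assume "\<forall>x. jet2 w G (H x) x" "\<forall>x. norm (G x) \<le> 1"
      and "\<forall>x. trace (H x) = A x * (1 - (norm (G x))\<^sup>2)" "\<forall>x. \<bar>A x\<bar> \<le> K"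
      and zp: "norm (z - p) \<le> \<rho> - 1" and qp: "norm (q - p) \<ge> R0" and zq: "w z - w q + norm (z - q) \<ge> 1 / 2"
    then have w: "\<And>x. jet2 w G (H x) x" and G: "\<And>x. norm (G x) \<le> 1"
      and tr: "\<And>x. trace (H x) = A x * (1 - (norm (G x))\<^sup>2)" and A: "\<And>x. \<bar>A x\<bar> \<le> K"
      by blast+
    have lip: "\<bar>w x - w y\<bar> \<le> norm (x - y)" for x y
      using Lipschitz_of_gradient[OF jet2_has_derivative[OF w] G, of x y] by simp
    define \<zeta> where "\<zeta> = (\<lambda>x. w x + norm (x - q) - w q)"
    have \<zeta>0: "\<zeta> x \<ge> 0" for x using lip[of x q] by (simp add: \<zeta>_def)
    \<comment> \<open>\<open>\<zeta>\<close> is 2-Lipschitz, so it loses at most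
      \<open>2 / 8\<close> from the value \<open>1 / 2\<close> at \<open>z\<close>.\<close>
    have \<zeta>near: "\<zeta> x \<ge> 1 / 4" if "norm (x - z) \<le> 1 / 8" for x
    proof -
      have "norm (z - q) \<le> norm (z - x) + norm (x - q)" using norm_triangle_ineq[of "z - x" "x - q"] by simp
      then show ?thesis using lip[of x z] zq that by (simp add: \<zeta>_def norm_minus_commute)
    qed
    define v where "v = (\<lambda>x. (exp (- \<alpha> * (norm (x - z))\<^sup>2) - exp (- \<alpha> * \<rho>\<^sup>2)) / 4)"
    have v4: "v x \<le> 1 / 4" for x
    proof -
      have "exp (- \<alpha> * (norm (x - z))\<^sup>2) \<le> 1" using \<alpha> by simp
      then show ?thesis unfolding v_def by (smt (verit) exp_gt_zero divide_right_mono)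
    qed
    define S where "S = {x. 1 / 8 \<le> norm (x - z) \<and> norm (x - z) \<le> \<rho>}"
    have claim: "v y \<le> \<zeta> y" if yS: "y \<in> S" for y
    proof (rule ccontr)
      assume neg: "\<not> v y \<le> \<zeta> y"
      have "S \<subseteq> cball z \<rho>" by (auto simp: S_def dist_norm norm_minus_commute)
      moreover have "closed S" unfolding S_def by (intro closed_Collect_conj closed_Collect_le continuous_intros)
      ultimately have "compact S" using bounded_subset[OF bounded_cball] compact_eq_bounded_closed by blast
      moreover have cw: "continuous_on S w"
        using has_derivative_continuous[OF jet2_has_derivative[OF w]] by (simp add: continuous_at_imp_continuous_on)
      have "continuous_on S (\<lambda>x. \<zeta> x - v x)"
        unfolding \<zeta>_def v_def by (intro continuous_intros cw) auto
      ultimately obtain x where x: "x \<in> S" "\<And>x'. x' \<in> S \<Longrightarrow> \<zeta> x - v x \<le> \<zeta> x' - v x'"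
        using continuous_attains_inf[of S "\<lambda>x. \<zeta> x - v x"] yS by blast
      have xneg: "\<zeta> x < v x" using x(2)[OF yS] neg by linarith
      define r where "r = norm (x - z)"
      \<comment> \<open>On the outer sphere \<open>v = 0 \<le> \<zeta>\<close>, on the inner one
        \<open>v \<le> 1 / 4 \<le> \<zeta>\<close>; a negative minimum of \<open>\<zeta> - v\<close>
        is therefore interior.\<close>
      have "r \<noteq> \<rho>" using xneg \<zeta>0[of x] by (auto simp: v_def r_def)
      moreover have "r \<noteq> 1 / 8" using xneg \<zeta>near[of x] v4[of x] by (auto simp: r_def)
      ultimately have r: "1 / 8 < r" "r < \<rho>" using x(1) by (auto simp: S_def r_def)
      have "norm (q - p) \<le> norm (x - q) + norm (x - z) + norm (z - p)"
        using norm_triangle_ineq[of "q - x" "x - p"] norm_triangle_ineq[of "x - z" "z - p"]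
        by (simp add: norm_minus_commute)
      then have far: "norm (x - q) \<ge> 4 * n * exp (\<alpha> * \<rho>\<^sup>2)"
        using qp zp r by (simp add: R0_def r_def)
      have pe: "4 * n * exp (\<alpha> * \<rho>\<^sup>2) > 0" using n by simp
      then have nq: "norm (x - q) > 0" using far by linarith
      then have xq: "x \<noteq> q" by auto
      obtain Hn where Hn: "jet2 (\<lambda>y. norm (y - q)) (\<lambda>y. (1 / norm (y - q)) *\<^sub>R (y - q)) Hn x"
          "trace Hn = (n - 1) / norm (x - q)"
        using jet2_norm[OF xq] by (auto simp: n_def)
      define E where "E = exp (- \<alpha> * r\<^sup>2)"
      have E: "E > 0" by (simp add: E_def)
      let ?\<phi> = "\<lambda>s. - w q - (exp (- \<alpha> * s) - exp (- \<alpha> * \<rho>\<^sup>2)) / 4"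
      let ?\<phi>' = "\<lambda>s. \<alpha> * exp (- \<alpha> * s) / 4"
      have "jet2 (\<lambda>x. ?\<phi> ((norm (x - z))\<^sup>2)) (\<lambda>x. ?\<phi>' ((norm (x - z))\<^sup>2) *\<^sub>R (2 *\<^sub>R (x - z)))
        (\<chi> i j. ?\<phi>' ((norm (x - z))\<^sup>2) * (2 *\<^sub>R mat 1 :: real^'n^'n) $ i $ j
           + (- \<alpha>\<^sup>2 * E / 4) * (2 *\<^sub>R (x - z)) $ i * (2 *\<^sub>R (x - z)) $ j) x"
        by (rule jet2_compose[OF jet2_norm_sq])
           (auto intro!: derivative_eq_intros always_eventually simp: E_def r_def power2_eq_square)
      moreover have "trace (\<chi> i j. ?\<phi>' ((norm (x - z))\<^sup>2) * (2 *\<^sub>R mat 1 :: real^'n^'n) $ i $ j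
           + (- \<alpha>\<^sup>2 * E / 4) * (2 *\<^sub>R (x - z)) $ i * (2 *\<^sub>R (x - z)) $ j) = E / 4 * (2 * n * \<alpha> - 4 * \<alpha>\<^sup>2 * r\<^sup>2)"
        unfolding trace_compose norm_scaleR
        by (simp add: trace_def mat_def E_def r_def n_def power_mult_distrib algebra_simps)
      ultimately obtain Hv where Hv: "jet2 (\<lambda>x. - w q - v x) (\<lambda>x. ?\<phi>' ((norm (x - z))\<^sup>2) *\<^sub>R (2 *\<^sub>R (x - z))) Hv x"
          "trace Hv = E / 4 * (2 * n * \<alpha> - 4 * \<alpha>\<^sup>2 * r\<^sup>2)"
        unfolding v_def by blast
      note j = jet2_add[OF jet2_add[OF w Hn(1)] Hv(1)]
      have "open {y. 1 / 8 < norm (y - z) \<and> norm (y - z) < \<rho>}"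
        by (intro open_Collect_conj open_Collect_less continuous_intros)
      from eventually_nhds_in_open[OF this, of x]
      have "\<forall>\<^sub>F y in nhds x. 1 / 8 < norm (y - z) \<and> norm (y - z) < \<rho>"
        using r by (simp add: r_def)
      then have loc: "\<forall>\<^sub>F y in nhds x. w x + norm (x - q) + (- w q - v x) \<le> w y + norm (y - q) + (- w q - v y)"
      proof eventually_elim
        case (elim y)
        then show ?case using x(2)[of y] by (simp add: S_def \<zeta>_def)
      qed
      define e where "e = (1 / norm (x - q)) *\<^sub>R (x - q)"
      define d where "d = (\<alpha> * E / 4) *\<^sub>R (2 *\<^sub>R (x - z))"
      have e: "norm e = 1" using xq by (simp add: e_def)
      have "G x + (e + d) = 0"
        using jet2_local_min(1)[OF j loc] by (simp add: e_def d_def E_def r_def add.assoc)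
      then have Gx: "G x = - (e + d)" by (simp only: eq_neg_iff_add_eq_0)
      have nd: "norm d = \<alpha> * E / 2 * r" using \<alpha> E by (simp add: d_def r_def)
      have "d = - G x - e" by (simp add: Gx)
      then have d2: "norm d \<le> 2" using norm_triangle_ineq4[of "- G x" e] G[of x] e by simp
      \<comment> \<open>Here \<open>d\<close> is minus the gradient of \<open>v\<close> and
        \<open>e\<close> is a unit vector, so the deviation of \<open>|Dw|\<^sup>2\<close> from 1 is
        at most linear in \<open>|d|\<close>; this makes the right-hand side of the equation a
        first-order term.\<close>
      have "1 - (norm (G x))\<^sup>2 = - (2 * (e \<bullet> d) + (norm d)\<^sup>2)"
      proof -
        have "e \<bullet> e = 1" using e by (simp add: norm_eq_sqrt_inner)
        then show ?thesis
          by (simp add: Gx power2_norm_eq_inner inner_diff_left inner_diff_right inner_commute)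
      qed
      moreover have "\<bar>e \<bullet> d\<bar> \<le> norm d" using Cauchy_Schwarz_ineq2[of e d] e by simp
      moreover have "(norm d)\<^sup>2 \<le> 2 * norm d" using d2 by (simp add: power2_eq_square mult_right_mono)
      ultimately have "\<bar>1 - (norm (G x))\<^sup>2\<bar> \<le> 4 * norm d"
        using zero_le_power2[of "norm d"] by linarith
      then have "\<bar>trace (H x)\<bar> \<le> K * (4 * norm d)"
        unfolding tr abs_mult using A[of x] assms by (intro mult_mono) auto
      moreover have "trace (H x) + (n - 1) / norm (x - q) + E / 4 * (2 * n * \<alpha> - 4 * \<alpha>\<^sup>2 * r\<^sup>2) \<ge> 0"
        using jet2_local_min(2)[OF j loc] by (simp add: trace_add Hn(2) Hv(2))
      ultimately have "0 \<le> K * (4 * norm d) + (n - 1) / norm (x - q) + E / 4 * (2 * n * \<alpha> - 4 * \<alpha>\<^sup>2 * r\<^sup>2)"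
        by linarith
      then have main: "E / 4 * (4 * \<alpha>\<^sup>2 * r\<^sup>2 - 2 * n * \<alpha> - 8 * K * \<alpha> * r) \<le> (n - 1) / norm (x - q)"
        by (simp add: nd algebra_simps)
      have "1 \<le> 4 * \<alpha>\<^sup>2 * r\<^sup>2 - 2 * n * \<alpha> - 8 * K * \<alpha> * r"
      proof -
        have "(1 / 8)\<^sup>2 \<le> r\<^sup>2" using r by (intro power_mono) auto
        then have "\<alpha> * (1 / 16) \<le> \<alpha> * (4 * r\<^sup>2)" using \<alpha> by (intro mult_left_mono) (auto simp: power2_eq_square)
        moreover have "8 * K * r \<le> 8 * K * \<rho>" using r assms by (intro mult_left_mono) auto
        moreover have "\<alpha> * (1 / 16) = 2 * n + 8 * K * \<rho> + 1" by (simp add: \<alpha>_def)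
        ultimately have "1 \<le> 4 * \<alpha> * r\<^sup>2 - 2 * n - 8 * K * r" by linarith
        then have "1 * 1 \<le> \<alpha> * (4 * \<alpha> * r\<^sup>2 - 2 * n - 8 * K * r)" using \<alpha> by (intro mult_mono) auto
        then show ?thesis by (simp add: power2_eq_square algebra_simps)
      qed
      then have "E / 4 * 1 \<le> E / 4 * (4 * \<alpha>\<^sup>2 * r\<^sup>2 - 2 * n * \<alpha> - 8 * K * \<alpha> * r)"
        using E by (intro mult_left_mono) auto
      with main have "E / 4 \<le> (n - 1) / norm (x - q)" by linarith
      also have "\<dots> \<le> (n - 1) / (4 * n * exp (\<alpha> * \<rho>\<^sup>2))"
        by (rule divide_left_mono[OF far _ mult_pos_pos[OF nq pe]]) (use n in simp)
      also have "\<dots> < exp (- \<alpha> * \<rho>\<^sup>2) / 4"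
        using n by (simp add: exp_minus field_simps)
      finally have "E < exp (- \<alpha> * \<rho>\<^sup>2)" by simp
      \<comment> \<open>A drop of \<open>E\<close> below its value on the outer sphere would place
        \<open>x\<close> outside the annulus.\<close>
      then have "\<rho>\<^sup>2 < r\<^sup>2" using \<alpha> by (simp add: E_def)
      moreover have "r\<^sup>2 \<le> \<rho>\<^sup>2" using r by (intro power_mono) auto
      ultimately show False by simp
    qed
    show "w p - w q + norm (p - q) \<ge> c1"
    proof (cases "norm (p - z) < 1 / 8")
      case True
      have "c1 \<le> 1 / 4"
      proof -
        have "exp (- \<alpha> * (\<rho> - 1)\<^sup>2) \<le> 1" using \<alpha> by simp
        then show ?thesis unfolding c1_def by (smt (verit) exp_gt_zero divide_right_mono)
      qed
      then show ?thesis using \<zeta>near[of p] True by (simp add: \<zeta>_def)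
    next
      case False
      have le: "norm (p - z) \<le> \<rho> - 1" using zp by (simp add: norm_minus_commute)
      then have "v p \<le> \<zeta> p" using False by (intro claim) (simp add: S_def)
      moreover have "c1 \<le> v p"
      proof -
        have "(norm (p - z))\<^sup>2 \<le> (\<rho> - 1)\<^sup>2" using le by (intro power_mono) auto
        then show ?thesis using \<alpha> by (simp add: c1_def v_def divide_right_mono)
      qed
      ultimately show ?thesis by (simp add: \<zeta>_def)
    qed
  qed
qed

section \<open>Sliding a radial barrier\<close>

lemma open_forall_compact:
  fixes f :: "'a::metric_space \<Rightarrow> 'b::metric_space \<Rightarrow> real"
  assumes "compact K" and cont: "continuous_on UNIV (\<lambda>(y, z). f y z)"
  shows "open {y. \<forall>z\<in>K. f y z > 0}"
proof (subst open_subopen, intro ballI)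
  fix y0 assume "y0 \<in> {y. \<forall>z\<in>K. f y z > 0}"
  then have "{y0} \<times> K \<subseteq> {p. (case p of (y, z) \<Rightarrow> f y z) > 0}" by auto
  moreover have "open {p. (case p of (y, z) \<Rightarrow> f y z) > 0}"
    using cont by (intro open_Collect_less) (auto intro: continuous_on_const)
  ultimately obtain X where "y0 \<in> X" "open X" "X \<times> K \<subseteq> {p. (case p of (y, z) \<Rightarrow> f y z) > 0}"
    using Elementary_Topology.tube_lemma[OF \<open>compact K\<close>] by metis
  then show "\<exists>T. open T \<and> y0 \<in> T \<and> T \<subseteq> {y. \<forall>z\<in>K. f y z > 0}"
    by (intro exI[of _ X]) auto
qed

lemma closed_forall:
  fixes f :: "'a::metric_space \<Rightarrow> 'b::metric_space \<Rightarrow> real"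
  assumes cont: "continuous_on UNIV (\<lambda>(y, z). f y z)"
  shows "closed {y. \<forall>z\<in>K. f y z \<ge> 0}"
proof -
  have "continuous_on UNIV (\<lambda>y. f y z)" for z
  proof -
    have "continuous_on UNIV (\<lambda>y :: 'a. (y, z))" by (intro continuous_intros)
    from continuous_on_compose2[OF cont this] show ?thesis by simp
  qed
  then have "closed {y. f y z \<ge> 0}" for z
    by (intro closed_Collect_le) (auto intro: continuous_on_const)
  then have "closed (\<Inter>z\<in>K. {y. f y z \<ge> 0})" by blast
  moreover have "(\<Inter>z\<in>K. {y. f y z \<ge> 0}) = {y. \<forall>z\<in>K. f y z \<ge> 0}" by auto
  ultimately show ?thesis by simp
qed

text \<open>Connectedness replaces a sliding path: the centres with strict inequalities form an open
  set, those with weak ones a closed set, and equality of the two would make a proper nonempty set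
  clopen.\<close>

lemma first_contact:
  fixes f h :: "'a::euclidean_space \<Rightarrow> 'a \<Rightarrow> real"
  assumes K: "compact A" "compact B"
    and cont: "continuous_on UNIV (\<lambda>(y, z). f y z)" "continuous_on UNIV (\<lambda>(y, z). h y z)"
    and start: "(\<forall>z\<in>A. f y0 z > 0) \<and> (\<forall>z\<in>B. h y0 z > 0)"
    and stop: "\<not> ((\<forall>z\<in>A. f y1 z > 0) \<and> (\<forall>z\<in>B. h y1 z > 0))"
  obtains y where "\<And>z. z \<in> A \<Longrightarrow> f y z \<ge> 0" "\<And>z. z \<in> B \<Longrightarrow> h y z \<ge> 0"
    "(\<exists>z\<in>A. f y z = 0) \<or> (\<exists>z\<in>B. h y z = 0)"
proof -
  define S where "S = {y. \<forall>z\<in>A. f y z > 0} \<inter> {y. \<forall>z\<in>B. h y z > 0}"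
  define T where "T = {y. \<forall>z\<in>A. f y z \<ge> 0} \<inter> {y. \<forall>z\<in>B. h y z \<ge> 0}"
  have "open S" unfolding S_def using K cont by (intro open_Int open_forall_compact)
  moreover have "closed T" unfolding T_def using cont by (intro closed_Int closed_forall)
  moreover have "S \<noteq> {}" "S \<noteq> UNIV" using start stop by (auto simp: S_def)
  ultimately have "\<not> T \<subseteq> S"
  proof (intro notI)
    assume "T \<subseteq> S"
    moreover have "S \<subseteq> T" by (auto simp: S_def T_def less_imp_le)
    ultimately have "S = T" by simp
    with \<open>open S\<close> \<open>closed T\<close> \<open>S \<noteq> {}\<close> \<open>S \<noteq> UNIV\<close> show False using clopen[of S] by simp
  qed
  then obtain y where "y \<in> T" "y \<notin> S" by blast
  then have "(\<forall>z\<in>A. f y z \<ge> 0) \<and> (\<forall>z\<in>B. h y z \<ge> 0)" "(\<exists>z\<in>A. \<not> f y z > 0) \<or> (\<exists>z\<in>B. \<not> h y z > 0)"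
    by (auto simp: S_def T_def)
  then show thesis using that[of y] by (metis less_eq_real_def)
qed

text \<open>
  The barrier is the maximum of two radial strict subsolutions: a paraboloid near the top level \<open>st\<close>, and,
  for \<open>r \<ge> r2\<close>, the profile given by \<open>\<Psi> = c - r\<close> with \<open>\<Psi>' = F\<^bsup>-1/2\<^esup>\<close> and \<open>F'/2 = W' + \<delta>\<close>, where \<open>\<delta>\<close>
  absorbs the curvature term \<open>(n - 1)/r\<close>. The paraboloid is so flat that \<open>r2\<close> is large, and is
  still the steeper of the two at the crossing in \<open>(r2, r3)\<close>, so the kink is convex and
  touching is possible only on the outer sphere.
\<close>

lemma sliding_contact:
  fixes u :: "real^'n::finite \<Rightarrow> real"
  assumes u: "\<And>x. jet2 u g (H x) x"
    and eq: "\<And>x. trace (H x) = W' (u x)"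
    and W: "\<And>s. (W has_real_derivative W' s) (at s)" and W0: "\<And>s. 0 \<le> W s" and Wb: "W b = 0"
    and cW': "continuous_on {a..b} W'" and neg: "\<And>s. a < s \<Longrightarrow> s < b \<Longrightarrow> W' s < 0"
    and levels: "a < a'" "a' < sb" "sb < b"
    and \<kappa>: "\<kappa> > 0" and \<Phi>: "\<And>s. (\<Phi> has_real_derivative 1 / sqrt (2 * W s + \<kappa>)) (at s)"
    and R0: "R0 > 0" "\<Phi> sb - \<Phi> a' \<ge> R0"
    and \<theta>: "0 < \<theta>" "\<theta> < 1" "(1 - \<theta>)\<^sup>2 * (2 * W sb + \<kappa>) < 2 * W sb"
    and x1: "u x1 < b" and big: "\<And>r s. s < b \<Longrightarrow> \<exists>y. \<forall>x. norm (x - y) \<le> r \<longrightarrow> s < u x"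
  obtains p e where "norm e = 1" "u p = a'" "\<Phi> (u (p + R0 *\<^sub>R e)) \<ge> \<Phi> a' + (1 - \<theta>) * R0"
proof -
  define n where "n = real CARD('n)"
  have n: "n \<ge> 1" by (simp add: n_def Suc_leI)
  have cu: "continuous_on UNIV u"
    using has_derivative_continuous[OF jet2_has_derivative[OF u]] by (simp add: continuous_at_imp_continuous_on)
  have Wmono: "W t \<le> W s" if "a \<le> s" "s \<le> t" "t \<le> b" for s t
  proof (rule DERIV_nonpos_imp_decreasing_open[OF that(2)])
    show "\<exists>y. (W has_real_derivative y) (at x) \<and> y \<le> 0" if "s < x" "x < t" for x
      using W[of x] neg[of x] that \<open>a \<le> s\<close> \<open>t \<le> b\<close> by (auto intro!: exI[of _ "W' x"])
    show "continuous_on {s..t} W"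
      using DERIV_isCont[OF W] by (auto intro: continuous_at_imp_continuous_on)
  qed
  \<comment> \<open>The slack in the hypothesis on \<open>\<theta>\<close>; half of it is spent on
    \<open>W s2\<close> and half on \<open>\<delta>\<close>.\<close>
  define \<gamma> where "\<gamma> = 2 * W sb - (1 - \<theta>)\<^sup>2 * (2 * W sb + \<kappa>)"
  have \<gamma>: "\<gamma> > 0" using \<theta> by (simp add: \<gamma>_def)
  have "\<exists>s2. max sb (u x1) < s2 \<and> s2 < b \<and> 2 * W s2 < \<gamma> / 2"
  proof -
    have "(W \<longlongrightarrow> W b) (at_left b)"
      using DERIV_isCont[OF W[of b]] by (simp add: isCont_def filterlim_at_split)
    then have "\<forall>\<^sub>F s in at_left b. W s < \<gamma> / 4" using \<gamma> Wb by (intro order_tendstoD(2)) auto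
    moreover have "\<forall>\<^sub>F s in at_left b. max sb (u x1) < s"
      using eventually_at_left_real[of "max sb (u x1)" b] levels x1 by (auto elim: eventually_mono)
    moreover have "\<forall>\<^sub>F s in at_left b. s < b"
      by (auto simp: eventually_at_filter)
    ultimately have "\<forall>\<^sub>F s in at_left b. max sb (u x1) < s \<and> s < b \<and> 2 * W s < \<gamma> / 2"
      by eventually_elim auto
    then show ?thesis using eventually_happens'[OF trivial_limit_at_left_real] by blast
  qed
  then obtain s2 where s2: "sb < s2" "u x1 < s2" "s2 < b" "2 * W s2 < \<gamma> / 2" by auto
  define st where "st = (s2 + b) / 2"
  have st: "s2 < st" "st < b" using s2 by (auto simp: st_def)
  obtain \<alpha> where \<alpha>: "\<alpha> > 0" "\<And>s. s \<in> {a'..st} \<Longrightarrow> W' s \<le> - \<alpha>"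
  proof -
    have "continuous_on {a'..st} W'" by (rule continuous_on_subset[OF cW']) (use levels st in auto)
    then obtain x where "x \<in> {a'..st}" "\<And>s. s \<in> {a'..st} \<Longrightarrow> W' s \<le> W' x"
      using continuous_attains_sup[of "{a'..st}" W'] levels s2 st by force
    then show thesis using that[of "- W' x"] neg[of x] levels st by auto
  qed
  \<comment> \<open>Below \<open>\<alpha>\<close>, so that \<open>F\<close> stays positive on
    \<open>[a', s2]\<close>, and so small that it costs at most \<open>\<gamma> / 2\<close> in
    \<open>F\<close>.\<close>
  define \<delta> where "\<delta> = min (\<alpha> / 2) (\<gamma> / (4 * (b - a')))"
  have \<delta>: "\<delta> > 0" "\<delta> < \<alpha>" using \<alpha> \<gamma> levels by (auto simp: \<delta>_def)
  have "\<delta> \<le> \<gamma> / (4 * (b - a'))" by (simp add: \<delta>_def)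
  then have \<delta>\<gamma>: "2 * \<delta> * (b - a') \<le> \<gamma> / 2" using levels by (simp add: field_simps)
  define Gm where "Gm = sqrt (2 * W a' + 2)"
  have Gm: "Gm > 0" using W0[of a'] by (simp add: Gm_def)
  \<comment> \<open>The three bounds make the paraboloid a strict subsolution, make
    \<open>2 \<eta> \<le> \<kappa>\<close> and \<open>\<eta> \<le> 1\<close>, and make
    \<open>r2\<close> so large that \<open>\<delta>\<close> beats the curvature term.\<close>
  define \<beta> where "\<beta> = min (\<alpha> / (2 * n)) (min (2 * min 1 (\<kappa> / 2) / (st - s2)) ((st - s2) * \<delta>\<^sup>2 / (n * Gm)\<^sup>2))"
  have \<beta>: "\<beta> > 0" using \<alpha> n \<kappa> st \<delta> Gm by (simp add: \<beta>_def)
  have "\<beta> \<le> \<alpha> / (2 * n)" by (simp add: \<beta>_def)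
  then have \<beta>\<alpha>: "n * \<beta> < \<alpha>" using n \<alpha> by (simp add: field_simps)
  have "\<beta> \<le> 2 * min 1 (\<kappa> / 2) / (st - s2)" by (simp add: \<beta>_def)
  then have \<beta>\<kappa>: "\<beta> * (st - s2) \<le> 2 * min 1 (\<kappa> / 2)" using st by (simp add: field_simps)
  have "\<beta> \<le> (st - s2) * \<delta>\<^sup>2 / (n * Gm)\<^sup>2" by (simp add: \<beta>_def)
  then have \<beta>G: "\<beta> * (n * Gm)\<^sup>2 \<le> (st - s2) * \<delta>\<^sup>2" using n Gm by (simp add: pos_le_divide_eq)
  \<comment> \<open>The squared slope of the paraboloid at level \<open>s2\<close> is
    \<open>2 * T\<close>, that of the profile is \<open>F s2 = T\<close>: the paraboloid is the
    steeper one.\<close>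
  define T where "T = \<beta> * (st - s2)"
  define \<eta> where "\<eta> = T / 2"
  have T: "T > 0" using \<beta> st by (simp add: T_def)
  have \<eta>: "\<eta> > 0" "\<eta> \<le> 1" "2 * \<eta> \<le> \<kappa>" using T \<beta>\<kappa> by (auto simp: \<eta>_def T_def)
  \<comment> \<open>The radius at which the paraboloid has level \<open>s\<close>.\<close>
  define rad where "rad = (\<lambda>s. sqrt (2 * (st - s) / \<beta>))"
  have rad2: "(rad s)\<^sup>2 = 2 * (st - s) / \<beta>" "rad s \<ge> 0" if "s \<le> st" for s
    using that \<beta> by (auto simp: rad_def)
  define r2 where "r2 = rad s2"
  have r2: "r2 > 0" using st \<beta> by (simp add: r2_def rad_def)
  have r2G: "n * Gm < \<delta> * r2"
  proof (rule power2_less_imp_less)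
    have "(n * Gm)\<^sup>2 \<le> (st - s2) * \<delta>\<^sup>2 / \<beta>" using \<beta>G \<beta> by (simp add: field_simps)
    also have "\<dots> < \<delta>\<^sup>2 * (2 * (st - s2) / \<beta>)" using st \<beta> \<delta> by (simp add: field_simps)
    also have "\<dots> = (\<delta> * r2)\<^sup>2" using rad2(1)[of s2] st by (simp add: r2_def power_mult_distrib)
    finally show "(n * Gm)\<^sup>2 < (\<delta> * r2)\<^sup>2" .
  qed (use \<delta> r2 in simp)
  define F where "F = (\<lambda>s. 2 * (W s - W s2 + \<eta> - \<delta> * (s2 - s)))"
  have dF: "(F has_real_derivative 2 * (W' s + \<delta>)) (at s)" for s
    unfolding F_def by (auto intro!: derivative_eq_intros W)
  have isF: "isCont F s" for s using DERIV_isCont[OF dF] .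
  have Flow: "F s \<ge> 2 * \<eta>" if "s \<in> {a'..s2}" for s
  proof -
    have "W s2 - W s \<le> - \<alpha> * (s2 - s)"
      by (rule MVT_bounds(1)[OF _ W]) (use that \<alpha> st in auto)
    moreover have "\<delta> * (s2 - s) \<le> \<alpha> * (s2 - s)" using that \<delta> by (intro mult_right_mono) auto
    ultimately show ?thesis by (simp add: F_def)
  qed
  have Fhigh: "F s \<le> Gm\<^sup>2" "F s \<le> 2 * W s + \<kappa>" if "s \<in> {a'..s2}" for s
  proof -
    have "\<delta> * (s2 - s) \<ge> 0" using that \<delta> by simp
    then have "F s \<le> 2 * W s + 2 * \<eta>" using W0[of s2] by (simp add: F_def)
    moreover have "W s \<le> W a'" using that levels s2 by (intro Wmono) auto
    ultimately show "F s \<le> Gm\<^sup>2" "F s \<le> 2 * W s + \<kappa>"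
      using \<eta> W0[of a'] by (auto simp: Gm_def)
  qed
  have F\<theta>: "(1 - \<theta>)\<^sup>2 * (2 * W s + \<kappa>) \<le> F s" if "s \<in> {a'..sb}" for s
  proof -
    have "\<delta> * (s2 - s) \<le> \<delta> * (b - a')" using that \<delta> s2 by (intro mult_left_mono) auto
    then have "2 * W s - \<gamma> \<le> F s" using s2 \<delta>\<gamma> \<eta> by (simp add: F_def)
    moreover have "(1 - (1 - \<theta>)\<^sup>2) * W sb \<le> (1 - (1 - \<theta>)\<^sup>2) * W s"
    proof (rule mult_left_mono)
      show "W sb \<le> W s" using that levels by (intro Wmono) auto
      have "(1 - \<theta>)\<^sup>2 \<le> 1" using \<theta> by (intro power_le_one) auto
      then show "0 \<le> 1 - (1 - \<theta>)\<^sup>2" by simp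
    qed
    ultimately show ?thesis by (simp add: \<gamma>_def algebra_simps)
  qed
  \<comment> \<open>The truncation at \<open>\<eta>\<close> makes the integrand continuous on the
    whole line; it is inactive on \<open>[a', s2]\<close>.\<close>
  define f where "f = (\<lambda>s. 1 / sqrt (max (F s) \<eta>))"
  have fpos: "f s > 0" for s using \<eta> by (simp add: f_def)
  have "isCont f s" for s
    unfolding f_def using isF \<eta> by (intro continuous_intros) auto
  then obtain \<Psi> where \<Psi>: "\<And>s. (\<Psi> has_real_derivative f s) (at s)"
    using antiderivative_exists[of f] by blast
  have \<Psi>mono: "\<Psi> s < \<Psi> t" if "s < t" for s t
    by (rule DERIV_pos_imp_increasing[OF that]) (use \<Psi> fpos in blast)
  have fF: "f s = 1 / sqrt (F s)" if "s \<in> {a'..s2}" for s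
    using Flow[OF that] \<eta> by (simp add: f_def max_absorb1)
  have "\<exists>s3. sb < s3 \<and> s3 < s2 \<and> (\<forall>s\<in>{s3..s2}. F s < 2 * T)"
  proof -
    have "F s2 = T" by (simp add: F_def \<eta>_def)
    then have "\<forall>\<^sub>F s in nhds s2. F s < 2 * T"
      using isF[of s2] T by (intro order_tendstoD(2)[of _ "F s2"]) (auto simp: isCont_def tendsto_at_iff_tendsto_nhds)
    then obtain d where d: "d > 0" "\<And>s. dist s s2 < d \<Longrightarrow> F s < 2 * T" unfolding eventually_nhds_metric by blast
    define m where "m = min d (s2 - sb) / 2"
    have "m > 0" "m < d" "m < s2 - sb" using d s2 by (auto simp: m_def)
    then show ?thesis using d(2) by (intro exI[of _ "s2 - m"]) (auto simp: dist_real_def)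
  qed
  then obtain s3 where s3: "sb < s3" "s3 < s2" "\<And>s. s \<in> {s3..s2} \<Longrightarrow> F s < 2 * T" by blast
  define r3 where "r3 = rad s3"
  have r23: "r2 < r3" using s3 \<beta> by (simp add: r2_def r3_def rad_def divide_strict_right_mono)
  \<comment> \<open>Being steeper, the paraboloid descends from \<open>s2\<close> to
    \<open>s3\<close> within a shorter radial distance than the profile.\<close>
  have "r3 - r2 < \<Psi> s2 - \<Psi> s3"
  proof -
    have Tr: "sqrt (2 * T) = \<beta> * r2"
    proof -
      have "2 * T = (\<beta> * r2)\<^sup>2"
      proof -
        have "r2\<^sup>2 * \<beta> = 2 * (st - s2)" using rad2(1)[of s2] st \<beta> by (simp add: r2_def)
        moreover have "(\<beta> * r2)\<^sup>2 = \<beta> * (r2\<^sup>2 * \<beta>)" by (simp add: power2_eq_square)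
        ultimately show ?thesis by (simp add: T_def)
      qed
      then show ?thesis using \<beta> r2 by simp
    qed
    have "(r3 - r2) * (r3 + r2) = r3\<^sup>2 - r2\<^sup>2" by (simp add: power2_eq_square algebra_simps)
    also have "\<dots> = 2 * (s2 - s3) / \<beta>"
      using rad2(1)[of s2] rad2(1)[of s3] st s3 by (simp add: r2_def r3_def diff_divide_distrib algebra_simps)
    finally have e: "(r3 - r2) * (r3 + r2) = 2 * (s2 - s3) / \<beta>" .
    have "(r3 - r2) * (2 * r2) < (r3 - r2) * (r3 + r2)" using r23 by (intro mult_strict_left_mono) auto
    then have "(r3 - r2) * (2 * r2) < 2 * (s2 - s3) / \<beta>" unfolding e .
    then have "(r3 - r2) * (2 * r2) * \<beta> < 2 * (s2 - s3)" using \<beta> by (simp only: pos_less_divide_eq)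
    moreover have "(r3 - r2) * (2 * r2) * \<beta> = 2 * ((r3 - r2) * (\<beta> * r2))" by simp
    ultimately have "(r3 - r2) * (\<beta> * r2) < s2 - s3"
      by (simp only: mult_less_cancel_left_pos zero_less_numeral)
    then have "r3 - r2 < (s2 - s3) / sqrt (2 * T)" using Tr \<beta> r2 by (simp only: pos_less_divide_eq mult_pos_pos)
    also have "\<dots> = 1 / sqrt (2 * T) * (s2 - s3)" by simp
    also have "\<dots> \<le> \<Psi> s2 - \<Psi> s3"
    proof (rule MVT_bounds(2)[OF _ \<Psi>])
      fix z assume z: "s3 \<le> z" "z \<le> s2"
      then have z': "z \<in> {a'..s2}" using s3 levels by auto
      have "F z \<le> 2 * T" using s3(3)[of z] z by simp
      moreover have "F z > 0" using Flow[OF z'] \<eta> by simp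
      ultimately show "1 / sqrt (2 * T) \<le> f z"
        unfolding fF[OF z'] using T by (intro divide_left_mono mult_pos_pos) auto
    qed (use s3 in simp)
    finally show ?thesis .
  qed
  then have "r3 + \<Psi> s3 < r2 + \<Psi> s2" by simp
  \<comment> \<open>This offset puts the profile below the paraboloid at \<open>r2\<close> and above
    it at \<open>r3\<close>.\<close>
  then obtain c where c: "r3 + \<Psi> s3 < c" "c < r2 + \<Psi> s2" using dense by blast
  define r1 where "r1 = c - \<Psi> a'"
  have r13: "r3 < r1" using c \<Psi>mono[of a' s3] s3 levels by (simp add: r1_def)
  have "\<Psi> sb - \<Psi> a' \<ge> \<Phi> sb - \<Phi> a'"
  proof -
    have "0 * (sb - a') \<le> (\<Psi> sb - \<Phi> sb) - (\<Psi> a' - \<Phi> a')"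
    proof (rule MVT_bounds(2)[OF _ DERIV_diff[OF \<Psi> \<Phi>]])
      fix z assume "a' \<le> z" "z \<le> sb"
      then have z: "z \<in> {a'..s2}" using s2 by auto
      have "F z > 0" using Flow[OF z] \<eta> by simp
      then have "1 / sqrt (2 * W z + \<kappa>) \<le> 1 / sqrt (F z)"
        using Fhigh(2)[OF z] by (intro divide_left_mono mult_pos_pos) auto
      then show "0 \<le> f z - 1 / sqrt (2 * W z + \<kappa>)" using fF[OF z] by simp
    qed (use levels in simp)
    then show ?thesis by simp
  qed
  then have r12: "r1 - R0 \<ge> r2" using R0 c r23 \<Psi>mono[of sb s3] s3 by (simp add: r1_def)
  define A where "A = cball (0 :: real^'n) r3"
  define B where "B = {z :: real^'n. r2 \<le> norm z \<and> norm z \<le> r1}"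
  define f1 where "f1 = (\<lambda>y z. u (y + z) - (st - \<beta> / 2 * (norm z)\<^sup>2))"
  \<comment> \<open>Comparing \<open>\<Psi>(u)\<close> with \<open>c - norm z\<close> avoids
    inverting \<open>\<Psi>\<close>.\<close>
  define f2 where "f2 = (\<lambda>y z. \<Psi> (u (y + z)) + norm z - c)"
  have cV: "continuous_on UNIV (\<lambda>x. \<Psi> (u x))"
  proof (rule continuous_on_compose2[OF _ cu])
    show "continuous_on UNIV \<Psi>" using DERIV_isCont[OF \<Psi>] by (simp add: continuous_at_imp_continuous_on)
  qed simp
  have "\<exists>y. (\<forall>z\<in>A. f1 y z \<ge> 0) \<and> (\<forall>z\<in>B. f2 y z \<ge> 0) \<and> ((\<exists>z\<in>A. f1 y z = 0) \<or> (\<exists>z\<in>B. f2 y z = 0))"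
  proof -
    obtain y0 where y0: "\<And>x. norm (x - y0) \<le> r1 \<Longrightarrow> st < u x" using big[OF st(2), of r1] by blast
    show ?thesis
    proof (rule first_contact[of A B f1 f2 y0 x1])
      show "compact A" by (simp add: A_def)
      have "B \<subseteq> cball 0 r1" by (auto simp: B_def)
      moreover have "closed B" unfolding B_def by (intro closed_Collect_conj closed_Collect_le continuous_intros)
      ultimately show "compact B" using bounded_subset[OF bounded_cball] compact_eq_bounded_closed by blast
      show "continuous_on UNIV (\<lambda>(y, z). f1 y z)"
        unfolding f1_def split_beta by (intro continuous_intros continuous_on_compose2[OF cu]) auto
      show "continuous_on UNIV (\<lambda>(y, z). f2 y z)"
        unfolding f2_def split_beta by (intro continuous_intros continuous_on_compose2[OF cV]) auto
      show "(\<forall>z\<in>A. f1 y0 z > 0) \<and> (\<forall>z\<in>B. f2 y0 z > 0)"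
      proof (intro conjI ballI)
        fix z assume "z \<in> A"
        then have "st < u (y0 + z)" using r13 by (intro y0) (simp add: A_def)
        moreover have "\<beta> / 2 * (norm z)\<^sup>2 \<ge> 0" using \<beta> by simp
        ultimately show "f1 y0 z > 0" unfolding f1_def by linarith
      next
        fix z assume z: "z \<in> B"
        then have "st < u (y0 + z)" by (intro y0) (simp add: B_def)
        then have "\<Psi> s2 < \<Psi> (u (y0 + z))" using st by (intro \<Psi>mono) simp
        then show "f2 y0 z > 0" using c z by (simp add: f2_def B_def)
      qed
      have "\<not> f1 x1 0 > 0" using s2 st by (simp add: f1_def)
      moreover have "0 \<in> A" using r2 r23 by (simp add: A_def)
      ultimately show "\<not> ((\<forall>z\<in>A. f1 x1 z > 0) \<and> (\<forall>z\<in>B. f2 x1 z > 0))" by blast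
    qed blast
  qed
  then obtain y where y: "\<forall>z\<in>A. f1 y z \<ge> 0" "\<forall>z\<in>B. f2 y z \<ge> 0" "(\<exists>z\<in>A. f1 y z = 0) \<or> (\<exists>z\<in>B. f2 y z = 0)"
    by blast
  have mem: "z \<in> A \<longleftrightarrow> norm z \<le> r3" "z \<in> B \<longleftrightarrow> r2 \<le> norm z \<and> norm z \<le> r1" for z
    by (auto simp: A_def B_def)
  have f1: "f1 y z \<ge> 0" if "norm z \<le> r3" for z using y(1) that by (simp add: mem Ball_def)
  have f2: "f2 y z \<ge> 0" if "r2 \<le> norm z" "norm z \<le> r1" for z using y(2) that by (simp add: mem Ball_def)
  have contact: "(\<exists>z. norm z \<le> r3 \<and> f1 y z = 0) \<or> (\<exists>z. r2 \<le> norm z \<and> norm z \<le> r1 \<and> f2 y z = 0)"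
    using y(3) by (simp add: mem Bex_def conj_assoc)
  have "\<beta> / 2 * (rad s)\<^sup>2 = st - s" if "s \<le> st" for s
    unfolding rad2(1)[OF that] using \<beta> by (simp add: field_simps)
  from this[of s3] this[of s2] have \<psi>3: "st - \<beta> / 2 * r3\<^sup>2 = s3" and \<psi>2: "st - \<beta> / 2 * r2\<^sup>2 = s2"
    using s3 st by (simp_all only: r3_def r2_def)
  \<comment> \<open>On the sphere of radius \<open>r3\<close> the profile is the higher barrier;
    inside, contact with the paraboloid contradicts its being a strict subsolution.\<close>
  have no1: "f1 y z \<noteq> 0" if z: "norm z \<le> r3" for z
  proof
    assume 0: "f1 y z = 0"
    define x where "x = y + z"
    have xz: "x - y = z" by (simp add: x_def)
    show False
    proof (cases "norm z = r3")
      case True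
      then have "u x = s3" using 0 \<psi>3 by (simp add: f1_def x_def)
      then show False using f2[of z] True r23 r13 c by (simp add: f2_def x_def)
    next
      case False
      with z have lt: "norm z < r3" by simp
      obtain Hq where Hq: "jet2 (\<lambda>x. \<beta> / 2 * (norm (x - y))\<^sup>2) (\<lambda>x. (\<beta> / 2) *\<^sub>R (2 *\<^sub>R (x - y))) Hq x"
          "trace Hq = \<beta> / 2 * trace (2 *\<^sub>R mat 1 :: real^'n^'n)"
        using jet2_cmult[OF jet2_norm_sq] by blast
      have "\<forall>\<^sub>F x' in nhds x. norm (x' - y) < r3"
        using eventually_nhds_in_open[of "{x'. norm (x' - y) < r3}" x] lt
        by (simp add: xz open_Collect_less continuous_intros)
      then have "\<forall>\<^sub>F x' in nhds x. u x + \<beta> / 2 * (norm (x - y))\<^sup>2 \<le> u x' + \<beta> / 2 * (norm (x' - y))\<^sup>2"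
      proof eventually_elim
        case (elim x')
        then show ?case using f1[of "x' - y"] 0 by (simp add: f1_def x_def)
      qed
      from jet2_local_min(2)[OF jet2_add[OF u Hq(1)] this]
      have "0 \<le> W' (u x) + \<beta> * n"
        by (simp add: trace_add eq Hq(2)) (simp add: trace_def mat_def n_def)
      moreover have "u x \<in> {a'..st}"
      proof -
        have ux: "u x = st - \<beta> / 2 * (norm z)\<^sup>2" using 0 by (simp add: f1_def x_def)
        have "(norm z)\<^sup>2 \<le> r3\<^sup>2" using z by (intro power_mono) auto
        then have "\<beta> / 2 * (norm z)\<^sup>2 \<le> \<beta> / 2 * r3\<^sup>2" using \<beta> by (intro mult_left_mono) auto
        moreover have "\<beta> / 2 * (norm z)\<^sup>2 \<ge> 0" using \<beta> by simp
        ultimately show ?thesis using ux \<psi>3 s3 levels by simp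
      qed
      ultimately show False using \<alpha>(2)[of "u x"] \<beta>\<alpha> by (simp add: mult.commute)
    qed
  qed
  with contact obtain z where z: "r2 \<le> norm z" "norm z \<le> r1" and 0: "f2 y z = 0" by blast
  define x where "x = y + z"
  have xz: "x - y = z" by (simp add: x_def)
  have \<Psi>x: "\<Psi> (u x) = c - norm z" using 0 by (simp add: f2_def x_def)
  have \<Psi>less: "s < t" if "\<Psi> s < \<Psi> t" for s t using \<Psi>mono[of t s] that by (cases s t rule: linorder_cases) auto
  have "norm z \<noteq> r2"
  proof
    assume e: "norm z = r2"
    then have "u x \<ge> s2" using f1[of z] r23 \<psi>2 by (simp add: f1_def x_def)
    then have "\<Psi> (u x) \<ge> \<Psi> s2" using \<Psi>mono[of s2 "u x"] by (cases "s2 = u x") auto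
    then show False using \<Psi>x e c by simp
  qed
  with z have zr2: "r2 < norm z" by simp
  have "norm z = r1"
  proof (rule ccontr)
    assume "norm z \<noteq> r1"
    with z have zr1: "norm z < r1" by simp
    have "\<Psi> a' < \<Psi> (u x)" "\<Psi> (u x) < \<Psi> s2" using \<Psi>x zr1 zr2 c by (auto simp: r1_def)
    then have ux: "a' < u x" "u x < s2" using \<Psi>less by auto
    have uxi: "u x \<in> {a'..s2}" using ux by simp
    have Fx: "F (u x) > 0" using Flow[OF uxi] \<eta> by simp
    have "\<forall>\<^sub>F s in nhds (u x). s \<in> {a'<..<s2}" using ux by (intro eventually_nhds_in_open) auto
    then have ev: "\<forall>\<^sub>F s in nhds (u x). (\<Psi> has_real_derivative 1 / sqrt (F s)) (at s)"
    proof eventually_elim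
      case (elim s)
      then show ?case using \<Psi>[of s] fF[of s] by simp
    qed
    obtain HV where HV: "jet2 (\<lambda>y. \<Psi> (u y)) (\<lambda>y. (1 / sqrt (F (u y))) *\<^sub>R g y) HV x"
      "trace HV = (trace (H x) - 2 * (W' (u x) + \<delta>) / 2 * (norm ((1 / sqrt (F (u x))) *\<^sub>R g x))\<^sup>2) / sqrt (F (u x))"
      using jet2_profile[OF u ev dF Fx] by blast
    have xy: "x \<noteq> y" using zr2 r2 by (auto simp: x_def)
    obtain Hn where Hn: "jet2 (\<lambda>x. norm (x - y)) (\<lambda>x. (1 / norm (x - y)) *\<^sub>R (x - y)) Hn x"
      "trace Hn = (n - 1) / norm (x - y)"
      using jet2_norm[OF xy] by (auto simp: n_def)
    have "open {x'. r2 < norm (x' - y) \<and> norm (x' - y) < r1}"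
      by (intro open_Collect_conj open_Collect_less continuous_intros)
    from eventually_nhds_in_open[OF this, of x]
    have "\<forall>\<^sub>F x' in nhds x. r2 < norm (x' - y) \<and> norm (x' - y) < r1" using zr1 zr2 by (simp add: xz)
    then have "\<forall>\<^sub>F x' in nhds x. \<Psi> (u x) + norm (x - y) \<le> \<Psi> (u x') + norm (x' - y)"
    proof eventually_elim
      case (elim x')
      then show ?case using f2[of "x' - y"] \<Psi>x by (simp add: f2_def x_def)
    qed
    note m = jet2_local_min[OF jet2_add[OF HV(1) Hn(1)] this]
    have "(1 / sqrt (F (u x))) *\<^sub>R g x = - ((1 / norm (x - y)) *\<^sub>R (x - y))"
      using m(1) by (simp only: eq_neg_iff_add_eq_0)
    then have nV: "norm ((1 / sqrt (F (u x))) *\<^sub>R g x) = 1" using xy by simp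
    \<comment> \<open>At an interior contact the gradient of \<open>\<Psi>(u)\<close> has length 1,
      which cancels \<open>W'\<close> and leaves only \<open>- \<delta>\<close>, too negative for
      the curvature term beyond \<open>r2\<close>.\<close>
    have "trace HV = - \<delta> / sqrt (F (u x))" unfolding HV(2) nV by (simp add: eq add_divide_distrib)
    then have "\<delta> / sqrt (F (u x)) \<le> (n - 1) / norm z" using m(2) by (simp add: trace_add Hn(2) xz)
    moreover have "norm z > 0" using zr2 r2 by linarith
    ultimately have "\<delta> * norm z \<le> (n - 1) * sqrt (F (u x))" using Fx by (simp add: field_simps)
    also have "\<dots> \<le> n * Gm"
    proof (rule mult_mono)
      show "sqrt (F (u x)) \<le> Gm" using Fhigh(1)[OF uxi] Gm real_le_lsqrt by simp
    qed (use n Fx in auto)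
    also have "\<dots> < \<delta> * r2" by (rule r2G)
    finally show False using \<delta> zr2 by simp
  qed
  then have zr1: "norm z = r1" .
  have "\<Psi> (u x) = \<Psi> a'" using \<Psi>x zr1 by (simp add: r1_def)
  then have ux: "u x = a'" using \<Psi>mono[of a' "u x"] \<Psi>mono[of "u x" a'] by (cases "u x" a' rule: linorder_cases) auto
  have r1: "r1 > 0" using r13 r23 r2 by simp
  define e where "e = - ((1 / r1) *\<^sub>R z)"
  have e: "norm e = 1" using zr1 r1 by (simp add: e_def)
  \<comment> \<open>The point reached from the contact point by going \<open>R0\<close> towards the
    centre; it still lies in the shell \<open>B\<close>, where the barrier bounds \<open>u\<close>
    from below.\<close>
  define z' where "z' = (1 - R0 / r1) *\<^sub>R z"
  have q: "x + R0 *\<^sub>R e = y + z'" by (simp add: x_def e_def z'_def algebra_simps)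
  have nz': "norm z' = r1 - R0"
  proof -
    have "R0 \<le> r1" using r12 r2 by linarith
    then show ?thesis using zr1 r1 by (simp add: z'_def abs_if field_simps)
  qed
  then have "f2 y z' \<ge> 0" using r12 R0 by (intro f2) auto
  then have \<Psi>q: "\<Psi> (u (y + z')) \<ge> \<Psi> a' + R0" by (simp add: f2_def nz' r1_def)
  have \<Phi>mono: "\<Phi> s \<le> \<Phi> t" if "s \<le> t" for s t
  proof (rule DERIV_nonneg_imp_nondecreasing[OF that])
    show "\<exists>d. (\<Phi> has_real_derivative d) (at x) \<and> 0 \<le> d" for x
      using W0[of x] \<kappa> by (intro exI[of _ "1 / sqrt (2 * W x + \<kappa>)"] conjI \<Phi>) simp
  qed
  \<comment> \<open>Growth of \<open>\<Psi>(u)\<close> is passed on to \<open>\<Phi>(u)\<close>: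
    below \<open>sb\<close> by \<open>\<Phi>' \<ge> (1 - \<theta>) \<Psi>'\<close>, above
    \<open>sb\<close> by the length hypothesis on \<open>\<Phi>\<close>.\<close>
  have "\<Phi> (u (y + z')) \<ge> \<Phi> a' + (1 - \<theta>) * R0"
  proof (cases "u (y + z') \<ge> sb")
    case True
    have "(1 - \<theta>) * R0 \<le> 1 * R0" using \<theta> R0 by (intro mult_right_mono) auto
    then show ?thesis using \<Phi>mono[OF True] R0(2) by linarith
  next
    case False
    have "\<Psi> a' < \<Psi> (u (y + z'))" using \<Psi>q R0 by simp
    then have q': "a' < u (y + z')" by (rule \<Psi>less)
    have "0 * (u (y + z') - a') \<le> (\<Phi> (u (y + z')) - (1 - \<theta>) * \<Psi> (u (y + z'))) - (\<Phi> a' - (1 - \<theta>) * \<Psi> a')"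
    proof (rule MVT_bounds(2)[OF _ DERIV_diff[OF \<Phi> DERIV_cmult[OF \<Psi>]]])
      fix s assume s: "a' \<le> s" "s \<le> u (y + z')"
      have s': "s \<in> {a'..s2}" "s \<in> {a'..sb}" using s False s2 by auto
      have Ws: "2 * W s + \<kappa> > 0" using W0[of s] \<kappa> by simp
      have Fs: "F s > 0" using Flow[OF s'(1)] \<eta> by simp
      have "(1 - \<theta>) * sqrt (2 * W s + \<kappa>) = sqrt ((1 - \<theta>)\<^sup>2 * (2 * W s + \<kappa>))" using \<theta> by (simp add: real_sqrt_mult)
      also have "\<dots> \<le> sqrt (F s)" using F\<theta>[OF s'(2)] by simp
      finally show "0 \<le> 1 / sqrt (2 * W s + \<kappa>) - (1 - \<theta>) * f s"
        using Ws Fs by (simp add: fF[OF s'(1)] field_simps)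
    qed (use q' in simp)
    moreover have "(1 - \<theta>) * R0 \<le> (1 - \<theta>) * (\<Psi> (u (y + z')) - \<Psi> a')" using \<theta> \<Psi>q by (intro mult_left_mono) auto
    ultimately show ?thesis by (simp add: algebra_simps)
  qed
  then show thesis using that[OF e ux] q by simp
qed

section \<open>The Liouville theorem\<close>

text \<open>As \<open>W\<close> vanishes at least quadratically at \<open>b\<close>, the integral of
  \<open>1 / sqrt (2 * W)\<close> diverges logarithmically there; \<open>sb\<close> is chosen first,
  then \<open>\<kappa>\<close> small compared with it.\<close>

lemma arbitrarily_long_transition:
  fixes W :: "real \<Rightarrow> real"
  assumes cW: "\<And>s. isCont W s" and W0: "\<And>s. 0 \<le> W s"
    and pos: "\<And>s. a' \<le> s \<Longrightarrow> s < b \<Longrightarrow> 0 < W s"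
    and quad: "\<And>s. a' \<le> s \<Longrightarrow> s \<le> b \<Longrightarrow> W s \<le> L * (b - s)\<^sup>2" and "0 \<le> L" "a' < b"
    and R0: "0 < R0" and \<theta>: "0 < \<theta>" "\<theta> < 1"
  obtains \<kappa> \<Phi> sb where "\<kappa> > 0" "\<And>s. (\<Phi> has_real_derivative 1 / sqrt (2 * W s + \<kappa>)) (at s)"
    "a' < sb" "sb < b" "\<Phi> sb - \<Phi> a' \<ge> R0" "(1 - \<theta>)\<^sup>2 * (2 * W sb + \<kappa>) < 2 * W sb"
proof -
  define k where "k = sqrt (2 * L + 1)"
  have k: "k > 0" using \<open>0 \<le> L\<close> by (simp add: k_def)
  define d where "d = (b - a') * exp (- k * R0)"
  have d: "d > 0" "d < b - a'" using \<open>a' < b\<close> k R0 by (auto simp: d_def)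
  define sb where "sb = b - d"
  have sb: "a' < sb" "sb < b" using d by (auto simp: sb_def)
  have Wsb: "W sb > 0" using pos sb by simp
  have \<theta>2: "(1 - \<theta>)\<^sup>2 < 1" "(1 - \<theta>)\<^sup>2 > 0" using \<theta> by (auto simp: power_less_one_iff abs_square_less_1)
  \<comment> \<open>The first bound gives
    \<open>2 * W s + \<kappa> \<le> (k * (b - s))\<^sup>2\<close> up to \<open>sb\<close>, the
    second the inequality with \<open>\<theta>\<close>.\<close>
  define \<kappa> where "\<kappa> = min (d\<^sup>2) ((1 - (1 - \<theta>)\<^sup>2) * W sb)"
  have \<kappa>: "\<kappa> > 0" using d \<theta>2 Wsb by (simp add: \<kappa>_def)
  have "isCont (\<lambda>s. 1 / sqrt (2 * W s + \<kappa>)) s" for s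
    using W0[of s] \<kappa> by (intro continuous_intros cW) auto
  then obtain \<Phi> where \<Phi>: "\<And>s. (\<Phi> has_real_derivative 1 / sqrt (2 * W s + \<kappa>)) (at s)"
    using antiderivative_exists[of "\<lambda>s. 1 / sqrt (2 * W s + \<kappa>)"] by blast
  have "(1 - \<theta>)\<^sup>2 * \<kappa> < 1 * \<kappa>" using \<theta>2 \<kappa> by (intro mult_strict_right_mono) auto
  also have "\<dots> \<le> (1 - (1 - \<theta>)\<^sup>2) * W sb" by (simp add: \<kappa>_def)
  also have "\<dots> \<le> (1 - (1 - \<theta>)\<^sup>2) * (2 * W sb)" using \<theta>2 Wsb by (intro mult_left_mono) auto
  finally have gap: "(1 - \<theta>)\<^sup>2 * (2 * W sb + \<kappa>) < 2 * W sb" by (simp add: algebra_simps)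
  have "0 * (sb - a') \<le> (\<Phi> sb + ln (b - sb) / k) - (\<Phi> a' + ln (b - a') / k)"
  proof (rule MVT_bounds(2)[where f'="\<lambda>s. 1 / sqrt (2 * W s + \<kappa>) - 1 / (k * (b - s))"])
    fix s assume s: "a' \<le> s" "s \<le> sb"
    have bs: "b - s \<ge> d" using s by (simp add: sb_def)
    show "((\<lambda>s. \<Phi> s + ln (b - s) / k) has_real_derivative 1 / sqrt (2 * W s + \<kappa>) - 1 / (k * (b - s))) (at s)"
    proof -
      have "((\<lambda>s. ln (b - s) / k) has_real_derivative - (1 / (k * (b - s)))) (at s)"
        using bs d k by (auto intro!: derivative_eq_intros simp: field_simps)
      from DERIV_add[OF \<Phi> this] show ?thesis by simp
    qed
    have "2 * W s + \<kappa> \<le> 2 * (L * (b - s)\<^sup>2) + (b - s)\<^sup>2"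
    proof -
      have "W s \<le> L * (b - s)\<^sup>2" using s sb by (intro quad) auto
      moreover have "\<kappa> \<le> d\<^sup>2" by (simp add: \<kappa>_def)
      moreover have "d\<^sup>2 \<le> (b - s)\<^sup>2" using bs d by (intro power_mono) auto
      ultimately show ?thesis by linarith
    qed
    also have "\<dots> = (k * (b - s))\<^sup>2" using \<open>0 \<le> L\<close> by (simp add: k_def power_mult_distrib) (simp add: distrib_right)
    finally have "sqrt (2 * W s + \<kappa>) \<le> k * (b - s)" using k bs d by (intro real_le_lsqrt) auto
    then have "1 / (k * (b - s)) \<le> 1 / sqrt (2 * W s + \<kappa>)"
      using W0[of s] \<kappa> k bs d by (intro divide_left_mono mult_pos_pos) auto
    then show "0 \<le> 1 / sqrt (2 * W s + \<kappa>) - 1 / (k * (b - s))" by simp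
  qed (use sb in simp)
  moreover have "ln (b - sb) = ln (b - a') - k * R0"
    using \<open>a' < b\<close> by (simp add: sb_def d_def ln_mult)
  ultimately have "\<Phi> sb - \<Phi> a' \<ge> R0" using k by (simp add: diff_divide_distrib)
  then show thesis using that[OF \<kappa> \<Phi> sb _ gap] by blast
qed

theorem theorem1p3:
  fixes W :: "real \<Rightarrow> real"
    and a b \<Lambda> :: real
    and D :: "(real^'n::finite) set"
    and u :: "real^'n \<Rightarrow> real"
  assumes "CARD('n) \<ge> 2"
    and "a < b"
    and "C11_loc W"
    and "\<And>s. W s \<ge> 0"
    and "deriv W a = 0" and "deriv W b = 0"
    and "\<And>s. s \<in> {a<..<b} \<Longrightarrow> deriv W s < 0"
    and "W b = 0"
    and "open D" and "connected D"
    and "\<Lambda> > 0"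
    and "\<And>x r. ball x r \<subseteq> UNIV - D \<Longrightarrow> r \<le> \<Lambda>"
    and "C2 u"
    and "bounded (range u)"
    and "\<And>x. laplacian u x = deriv W (u x)"
    and "(SUP x. u x) = b"
    and "u ` D \<subseteq> {a<..b}"
  shows "\<forall>x. u x = b"
proof (rule ccontr)
  assume "\<not> (\<forall>x. u x = b)"
  note W0 = \<open>\<And>s. W s \<ge> 0\<close> and neg = \<open>\<And>s. s \<in> {a<..<b} \<Longrightarrow> deriv W s < 0\<close>
  define W' where "W' = deriv W"
  have W: "(W has_real_derivative W' s) (at s)" for s
    using assms(3) by (simp add: C11_loc_def W'_def DERIV_deriv_iff_real_differentiable)
  have Wb: "W b = 0" "W' b = 0" using assms by (auto simp: W'_def)
  have cW: "isCont W s" for s using DERIV_isCont[OF W] .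
  define H where "H = (\<lambda>x. (\<chi> i. gradient (partial i u) x))"
  define g where "g = gradient u"
  have u: "jet2 u g (H x) x" for x using C2_jet2(1)[OF \<open>C2 u\<close>] by (simp add: H_def g_def)
  have eq: "trace (H x) = W' (u x)" for x using C2_jet2(2)[OF \<open>C2 u\<close>] assms(15) by (simp add: H_def W'_def)
  have bdd: "bdd_above (range u)" using \<open>bounded (range u)\<close> by (rule bounded_imp_bdd_above)
  have ub: "u x \<le> b" for x using cSUP_upper[OF UNIV_I bdd, of x] assms(16) by simp
  obtain x1 where x1: "u x1 < b" using \<open>\<not> (\<forall>x. u x = b)\<close> ub by (metis less_eq_real_def)
  obtain lo where lo: "\<And>x. lo \<le> u x" "lo \<le> a"
  proof -
    obtain l where "\<And>x. l \<le> u x"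
      using bounded_imp_bdd_below[OF \<open>bounded (range u)\<close>] by (auto simp: bdd_below_def)
    then show thesis using that[of "min l a"] by (simp add: min.coboundedI1)
  qed
  \<comment> \<open>The margin 1 on both sides is the room that \<open>derivative_sq_le\<close>
    needs.\<close>
  obtain L where L0: "0 \<le> L" and L: "\<And>s t. s \<in> {lo-1..b+1} \<Longrightarrow> t \<in> {lo-1..b+1} \<Longrightarrow> \<bar>W' s - W' t\<bar> \<le> L * \<bar>s - t\<bar>"
  proof -
    obtain L where "L-lipschitz_on {lo-1..b+1} W'" using assms(3) by (auto simp: C11_loc_def W'_def)
    then show thesis using that[of L] by (auto simp: lipschitz_on_def dist_real_def)
  qed
  have cW': "continuous_on {a..b} W'"
  proof -
    have "L-lipschitz_on {a..b} W'" using L0 L lo by (auto simp: lipschitz_on_def dist_real_def)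
    then show ?thesis by (rule lipschitz_on_continuous_on)
  qed
  have quad: "W s \<le> L * (b - s)\<^sup>2" if "lo \<le> s" "s \<le> b" for s
  proof (rule quadratic_upper_bound[OF W Wb that(2) _ L0])
    show "\<bar>W' t - W' b\<bar> \<le> L * \<bar>t - b\<bar>" if "s \<le> t" "t \<le> b" for t
      by (rule L) (use that \<open>lo \<le> s\<close> in auto)
  qed
  have modica: "(norm (g x))\<^sup>2 \<le> 2 * W (u x)" for x
    by (rule modica_estimate[OF u lo(1) ub W W0 L eq]) auto
  have Wpos: "0 < W s" if "a \<le> s" "s < b" for s
  proof -
    have "W b < W s"
    proof (rule DERIV_neg_imp_decreasing_open[OF that(2)])
      show "\<exists>y. (W has_real_derivative y) (at x) \<and> y < 0" if "s < x" "x < b" for x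
        using W[of x] neg[of x] that \<open>a \<le> s\<close> by (auto simp: W'_def)
      show "continuous_on {s..b} W" using cW by (auto intro: continuous_at_imp_continuous_on)
    qed
    then show ?thesis using Wb by simp
  qed
  \<comment> \<open>A point with \<open>u\<close> exponentially close to \<open>b\<close> exists
    since \<open>b\<close> is the supremum; the decay bound spreads this over a ball of radius
    \<open>r\<close>.\<close>
  have big: "\<exists>y. \<forall>x. norm (x - y) \<le> r \<longrightarrow> s < u x" if "s < b" for r s
  proof -
    define k where "k = sqrt (2 * L)"
    have gk: "norm (g x) \<le> k * (b - u x)" for x
    proof (rule power2_le_imp_le)
      show "(norm (g x))\<^sup>2 \<le> (k * (b - u x))\<^sup>2"
        using order_trans[OF modica[of x], of "2 * (L * (b - u x)\<^sup>2)"] quad[OF lo(1) ub, of x] L0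
        by (simp add: k_def power_mult_distrib)
      show "0 \<le> k * (b - u x)" using L0 ub[of x] by (simp add: k_def)
    qed
    have "b - (b - s) * exp (- (k * r)) < (SUP x. u x)" using that assms(16) by simp
    then obtain y where y: "b - (b - s) * exp (- (k * r)) < u y"
      using less_cSUP_iff[OF _ bdd] by auto
    have "s < u x" if "norm (x - y) \<le> r" for x
    proof -
      have "b - u x \<le> (b - u y) * exp (k * norm (x - y))"
        by (rule exponential_decay[OF jet2_has_derivative[OF u] gk])
      also have "\<dots> \<le> (b - u y) * exp (k * r)"
        using that ub[of y] L0 by (intro mult_left_mono) (auto simp: k_def mult_left_mono)
      also have "\<dots> < (b - s) * exp (- (k * r)) * exp (k * r)"
        using y by (intro mult_strict_right_mono) auto
      also have "\<dots> = b - s" by (simp add: mult.assoc exp_add[symmetric])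
      finally show ?thesis by simp
    qed
    then show ?thesis by blast
  qed
  define M where "M = 2 * (2 * L + (\<bar>W' lo\<bar> + L * (b - lo)) + 1)"
  have M: "(W' (u x))\<^sup>2 \<le> M * W (u x)" for x
    unfolding M_def by (rule derivative_sq_le[OF W W0 L L0]) (use lo ub in auto)
  have M0: "M \<ge> 0" using L0 lo \<open>a < b\<close> by (simp add: M_def)
  \<comment> \<open>These constants precede \<open>\<kappa>\<close>, which is possible because
    \<open>sqrt M\<close> bounds the coefficient \<open>A\<close> for every \<open>\<kappa>\<close>.
    The radius \<open>2 * \<Lambda> + 4\<close> covers the ball around \<open>o'\<close>
    below.\<close>
  obtain c1 R0 where c1: "c1 > 0" "R0 > 0"
    and dist: "\<forall>(w :: real^'n \<Rightarrow> real) G H A p q z. (\<forall>x. jet2 w G (H x) x) \<longrightarrow> (\<forall>x. norm (G x) \<le> 1) \<longrightarrow>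
       (\<forall>x. trace (H x) = A x * (1 - (norm (G x))\<^sup>2)) \<longrightarrow> (\<forall>x. \<bar>A x\<bar> \<le> sqrt M) \<longrightarrow>
       norm (z - p) \<le> (2 * \<Lambda> + 4) - 1 \<longrightarrow> norm (q - p) \<ge> R0 \<longrightarrow> w z - w q + norm (z - q) \<ge> 1 / 2 \<longrightarrow>
       w p - w q + norm (p - q) \<ge> c1"
  proof (rule quantitative_strong_maximum[of "sqrt M" "2 * \<Lambda> + 4"])
    show "0 \<le> sqrt M" "1 < 2 * \<Lambda> + 4" using M0 \<open>\<Lambda> > 0\<close> by simp_all
  qed (erule that)
  define mid where "mid = (a + b) / 2"
  have mid: "a < mid" "mid < b" using \<open>a < b\<close> by (auto simp: mid_def)
  have Wmid: "W mid > 0" using Wpos mid by simp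
  \<comment> \<open>On \<open>[a, mid]\<close> the slope of \<open>\<Phi>\<close> is at most
    \<open>1 / sqrt (2 * W mid)\<close> for every \<open>\<kappa>\<close>, so
    \<open>\<Phi> a' - \<Phi> a \<le> 1 / 2\<close>.\<close>
  define a' where "a' = min mid (a + sqrt (2 * W mid) / 2)"
  have a'3: "a' \<le> a + sqrt (2 * W mid) / 2" by (simp add: a'_def)
  have a': "a < a'" "a' \<le> mid" using mid Wmid by (auto simp: a'_def)
  define \<theta> where "\<theta> = min (1/2) (c1 / (2 * R0))"
  have \<theta>: "0 < \<theta>" "\<theta> < 1" using c1 by (auto simp: \<theta>_def)
  have "\<theta> \<le> c1 / (2 * R0)" by (simp add: \<theta>_def)
  then have \<theta>c: "\<theta> * R0 < c1" using c1 by (simp add: field_simps)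
  have a'b: "a' < b" using a' mid by simp
  obtain \<kappa> \<Phi> sb where \<kappa>: "\<kappa> > 0" and \<Phi>: "\<And>s. (\<Phi> has_real_derivative 1 / sqrt (2 * W s + \<kappa>)) (at s)"
    and sb: "a' < sb" "sb < b" and long: "\<Phi> sb - \<Phi> a' \<ge> R0" and gap: "(1 - \<theta>)\<^sup>2 * (2 * W sb + \<kappa>) < 2 * W sb"
    by (rule arbitrarily_long_transition[OF cW W0 _ _ L0 a'b c1(2) \<theta>, of thesis])
      (use Wpos quad a' lo in auto)
  have Fpos: "2 * W s + \<kappa> > 0" for s using W0[of s] \<kappa> by simp
  have \<Phi>mono: "\<Phi> s \<le> \<Phi> t" if "s \<le> t" for s t
  proof (rule DERIV_nonneg_imp_nondecreasing[OF that])
    show "\<exists>d. (\<Phi> has_real_derivative d) (at x) \<and> 0 \<le> d" for x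
      using W0[of x] \<kappa> by (intro exI[of _ "1 / sqrt (2 * W x + \<kappa>)"] conjI \<Phi>) simp
  qed
  obtain p e where e: "norm e = 1" and p: "u p = a'" and pq: "\<Phi> (u (p + R0 *\<^sub>R e)) \<ge> \<Phi> a' + (1 - \<theta>) * R0"
  proof (rule sliding_contact[OF u eq W W0 Wb(1) cW' _ a'(1) sb \<kappa> \<Phi> c1(2) long \<theta> gap x1 big])
    show "W' s < 0" if "a < s" "s < b" for s using neg[of s] that by (simp add: W'_def)
  qed
  define w where "w = (\<lambda>x. \<Phi> (u x))"
  define G where "G = (\<lambda>x. (1 / sqrt (2 * W (u x) + \<kappa>)) *\<^sub>R g x)"
  define A where "A = (\<lambda>x. W' (u x) / sqrt (2 * W (u x) + \<kappa>))"
  have "\<exists>H'. jet2 w G H' x \<and> trace H' = A x * (1 - (norm (G x))\<^sup>2)" for x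
  proof -
    have d: "((\<lambda>s. 2 * W s + \<kappa>) has_real_derivative 2 * W' (u x)) (at (u x))"
      by (auto intro!: derivative_eq_intros W)
    show ?thesis
      using jet2_profile[OF u _ d Fpos, of \<Phi>] \<Phi>
      by (simp add: w_def G_def A_def eq algebra_simps diff_divide_distrib)
  qed
  then obtain Hw where Hw: "\<And>x. jet2 w G (Hw x) x" "\<And>x. trace (Hw x) = A x * (1 - (norm (G x))\<^sup>2)"
    by metis
  have G1: "norm (G x) \<le> 1" for x
  proof -
    have "(norm (G x))\<^sup>2 = (norm (g x))\<^sup>2 / (2 * W (u x) + \<kappa>)"
      using Fpos[of "u x"] by (simp add: G_def power_mult_distrib power_divide)
    also have "\<dots> \<le> 1" using modica[of x] Fpos[of "u x"] \<kappa> by simp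
    finally have "(norm (G x))\<^sup>2 \<le> 1\<^sup>2" by simp
    then show ?thesis by (rule power2_le_imp_le) simp
  qed
  have A1: "\<bar>A x\<bar> \<le> sqrt M" for x
  proof (rule power2_le_imp_le)
    have "(W' (u x))\<^sup>2 \<le> M * (2 * W (u x) + \<kappa>)"
      by (rule order_trans[OF M mult_left_mono[OF _ M0]]) (use W0[of "u x"] \<kappa> in simp)
    then show "\<bar>A x\<bar>\<^sup>2 \<le> (sqrt M)\<^sup>2"
      using M0 Fpos[of "u x"] by (simp add: A_def power_divide pos_divide_le_eq)
  qed (use M0 in simp)
  have lip: "\<bar>w x - w y\<bar> \<le> norm (x - y)" for x y
    using Lipschitz_of_gradient[OF jet2_has_derivative[OF Hw(1)] G1, of x y] by simp
  define q where "q = p + R0 *\<^sub>R e"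
  \<comment> \<open>The ball of radius \<open>\<Lambda> + 1\<close> about \<open>o'\<close> lies
    behind \<open>p\<close> as seen from \<open>q\<close>, at distance at least
    \<open>R0 + 1\<close> from \<open>q\<close>; being too large for the complement of
    \<open>D\<close>, it contains a point of \<open>D\<close>.\<close>
  define o' where "o' = p - (\<Lambda> + 2) *\<^sub>R e"
  have "\<not> ball o' (\<Lambda> + 1) \<subseteq> UNIV - D" using assms(12)[of o' "\<Lambda> + 1"] by auto
  then obtain z where z: "norm (z - o') < \<Lambda> + 1" "z \<in> D" by (auto simp: dist_norm norm_minus_commute)
  have "a < u z" using z assms(17) by auto
  then have wz: "w z \<ge> \<Phi> a" by (simp add: w_def \<Phi>mono)
  have "\<Phi> a' - \<Phi> a \<le> 1 / sqrt (2 * W mid) * (a' - a)"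
  proof (rule MVT_bounds(1)[OF _ \<Phi>])
    fix s assume s: "a \<le> s" "s \<le> a'"
    have "W mid \<le> W s"
    proof (rule DERIV_nonpos_imp_decreasing_open[of s mid W])
      show "\<exists>y. (W has_real_derivative y) (at x) \<and> y \<le> 0" if "s < x" "x < mid" for x
        using W[of x] neg[of x] that s mid by (auto simp: W'_def intro!: exI[of _ "deriv W x"])
      show "continuous_on {s..mid} W" using cW by (auto intro: continuous_at_imp_continuous_on)
    qed (use s a' in simp)
    then show "1 / sqrt (2 * W s + \<kappa>) \<le> 1 / sqrt (2 * W mid)"
      using Wmid \<kappa> Fpos[of s] by (intro divide_left_mono mult_pos_pos) auto
  qed (use a' in simp)
  also have "\<dots> \<le> 1 / sqrt (2 * W mid) * (sqrt (2 * W mid) / 2)"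
    using a'3 Wmid by (intro mult_left_mono) auto
  also have "\<dots> = 1 / 2" using Wmid by simp
  finally have \<Phi>a: "\<Phi> a' - \<Phi> a \<le> 1 / 2" .
  have nqp: "norm (q - p) = R0" using c1 e by (simp add: q_def)
  have "w q \<le> w p + R0" using lip[of q p] nqp by simp
  then have wq: "w q \<le> \<Phi> a' + R0" by (simp add: w_def p)
  have "norm (q - o') = R0 + \<Lambda> + 2"
  proof -
    have "q - o' = (R0 + \<Lambda> + 2) *\<^sub>R e" by (simp add: q_def o'_def algebra_simps)
    then show ?thesis using e c1 \<open>\<Lambda> > 0\<close> by simp
  qed
  then have "norm (z - q) \<ge> R0 + 1"
    using norm_triangle_ineq[of "q - z" "z - o'"] z by (simp add: norm_minus_commute)
  then have 1: "w z - w q + norm (z - q) \<ge> 1 / 2" using wz wq \<Phi>a by linarith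
  have "norm (o' - p) = \<Lambda> + 2" using e \<open>\<Lambda> > 0\<close> by (simp add: o'_def)
  then have 2: "norm (z - p) \<le> (2 * \<Lambda> + 4) - 1"
    using norm_triangle_ineq[of "z - o'" "o' - p"] z \<open>\<Lambda> > 0\<close> by simp
  \<comment> \<open>The excess is at least \<open>1 / 2\<close> at \<open>z\<close>, hence at least
    \<open>c1\<close> at \<open>p\<close>, but the sliding step bounds it at \<open>p\<close> by
    \<open>\<theta> * R0 < c1\<close>.\<close>
  have "w p - w q + norm (p - q) \<ge> c1"
    by (rule dist[rule_format, OF Hw(1) G1 Hw(2) A1 2 _ 1]) (simp add: nqp)
  moreover have "w p = \<Phi> a'" "w q \<ge> \<Phi> a' + (1 - \<theta>) * R0" using p pq by (auto simp: w_def q_def)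
  ultimately show False using nqp \<theta>c by (simp add: norm_minus_commute algebra_simps)
qed

end
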